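(* Let $\beta$ be a real number with $0<\beta$ sufficiently small compared with $1/(20\cdot 17^3)$, and let $n$ be a sufficiently large integer. Let $G$ be a graph on $n$ vertices with $\delta(G)\ge (n+1)/2$. If $G$ has a vertex-cut of size at most $5\beta n$, then $G$ contains a spanning Halin subgraph.
   Context: A homeomorphically irreducible tree (HIT) is a tree with no vertex of degree 2. A Halin graph is obtained from a HIT with at least 4 vertices embedded in the plane by connecting its leaves into a cycle following the cyclic order determined by the embedding. A spanning Halin subgraph of $G$ is a Halin subgraph of $G$ with vertex set $V(G)$. *)

theory Defs
  imports "HOL-Analysis.Analysis"
begin

section \<open>Finite simple graphs\<close>

text \<open>A graph is given by a vertex set \<open>V\<close> and a set \<open>E\<close> of two-element subsets of \<open>V\<close>.\<close>

definition simple_graph :: "'a set \<Rightarrow> 'a set set \<Rightarrow> bool" where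
  "simple_graph V E \<longleftrightarrow> finite V \<and> (\<forall>e\<in>E. e \<subseteq> V \<and> card e = 2)"

definition vdegree :: "'a set set \<Rightarrow> 'a \<Rightarrow> nat" where
  "vdegree E v = card {e \<in> E. v \<in> e}"

text \<open>Only meaningful for a finite nonempty vertex set.\<close>

definition min_degree :: "'a set \<Rightarrow> 'a set set \<Rightarrow> nat" where
  "min_degree V E = Min (vdegree E ` V)"

definition graph_walk :: "'a set \<Rightarrow> 'a set set \<Rightarrow> 'a list \<Rightarrow> bool" where
  "graph_walk V E xs \<longleftrightarrow>
     xs \<noteq> [] \<and> set xs \<subseteq> V \<and> (\<forall>i. Suc i < length xs \<longrightarrow> {xs ! i, xs ! Suc i} \<in> E)"

definition connected_graph :: "'a set \<Rightarrow> 'a set set \<Rightarrow> bool" where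
  "connected_graph V E \<longleftrightarrow>
     V \<noteq> {} \<and> (\<forall>u\<in>V. \<forall>v\<in>V. \<exists>xs. graph_walk V E xs \<and> hd xs = u \<and> last xs = v)"

text \<open>The graph left after deleting \<open>S\<close> must have at least two components; in particular
  deleting all vertices does not count as disconnecting the graph.\<close>

definition vertex_cut :: "'a set \<Rightarrow> 'a set set \<Rightarrow> 'a set \<Rightarrow> bool" where
  "vertex_cut V E S \<longleftrightarrow>
     S \<subseteq> V \<and> V - S \<noteq> {} \<and> \<not> connected_graph (V - S) {e \<in> E. e \<inter> S = {}}"

text \<open>The edges joining consecutive entries of a list, and its last entry to its first.\<close>

definition cycle_edges :: "'a list \<Rightarrow> 'a set set" where
  "cycle_edges c = {{c ! i, c ! (Suc i mod length c)} | i. i < length c}"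

definition acyclic_graph :: "'a set set \<Rightarrow> bool" where
  "acyclic_graph E \<longleftrightarrow> \<not> (\<exists>c. 3 \<le> length c \<and> distinct c \<and> cycle_edges c \<subseteq> E)"

definition tree_graph :: "'a set \<Rightarrow> 'a set set \<Rightarrow> bool" where
  "tree_graph V E \<longleftrightarrow> simple_graph V E \<and> connected_graph V E \<and> acyclic_graph E"

definition leaves :: "'a set \<Rightarrow> 'a set set \<Rightarrow> 'a set" where
  "leaves V E = {v \<in> V. vdegree E v = 1}"

definition hit :: "'a set \<Rightarrow> 'a set set \<Rightarrow> bool" where
  "hit V E \<longleftrightarrow> tree_graph V E \<and> (\<forall>v\<in>V. vdegree E v \<noteq> 2)"


section \<open>Embeddings in the plane and Halin graphs\<close>

text \<open>The plane is \<^typ>\<open>complex\<close>. A vertex \<open>v\<close> is drawn as the point \<open>p v\<close> and an edge \<open>e\<close> as the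
  arc \<open>\<gamma> e\<close> between the images of its ends; arcs meet vertices and each other only in the images
  of common ends.\<close>

definition plane_embedding ::
  "'a set \<Rightarrow> 'a set set \<Rightarrow> ('a \<Rightarrow> complex) \<Rightarrow> ('a set \<Rightarrow> real \<Rightarrow> complex) \<Rightarrow> bool" where
  "plane_embedding V E p \<gamma> \<longleftrightarrow>
     inj_on p V \<and>
     (\<forall>e\<in>E. arc (\<gamma> e) \<and> {pathstart (\<gamma> e), pathfinish (\<gamma> e)} = p ` e) \<and>
     (\<forall>e\<in>E. \<forall>v\<in>V. p v \<in> path_image (\<gamma> e) \<longrightarrow> v \<in> e) \<and>
     (\<forall>e\<in>E. \<forall>f\<in>E. e \<noteq> f \<longrightarrow> path_image (\<gamma> e) \<inter> path_image (\<gamma> f) \<subseteq> p ` (e \<inter> f))"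

definition drawing ::
  "'a set \<Rightarrow> 'a set set \<Rightarrow> ('a \<Rightarrow> complex) \<Rightarrow> ('a set \<Rightarrow> real \<Rightarrow> complex) \<Rightarrow> complex set" where
  "drawing V E p \<gamma> = p ` V \<union> (\<Union>e\<in>E. path_image (\<gamma> e))"

text \<open>The cyclic order of the leaves determined by a plane embedding of a tree: the order in which
  the leaves are passed by a simple closed curve \<open>J\<close> that runs around the drawn tree, touching
  it exactly in its leaves and having the rest of it in its interior. The order is determined up to
  rotation and reversal, neither of which affects \<^const>\<open>cycle_edges\<close>; the list \<open>ls\<close> represents
  it. The \<open>t i\<close> are the parameters at which \<open>J\<close> passes the leaves.\<close>

definition leaf_cyclic_order ::
  "'a set \<Rightarrow> 'a set set \<Rightarrow> ('a \<Rightarrow> complex) \<Rightarrow> ('a set \<Rightarrow> real \<Rightarrow> complex) \<Rightarrow> 'a list \<Rightarrow> bool" where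
  "leaf_cyclic_order V E p \<gamma> ls \<longleftrightarrow>
     distinct ls \<and> set ls = leaves V E \<and>
     (\<exists>J t. simple_path J \<and> pathfinish J = pathstart J \<and>
        drawing V E p \<gamma> \<inter> path_image J = p ` leaves V E \<and>
        drawing V E p \<gamma> - p ` leaves V E \<subseteq> inside (path_image J) \<and>
        strict_mono_on {..<length ls} t \<and>
        (\<forall>i<length ls. 0 \<le> t i \<and> t i < 1 \<and> J (t i) = p (ls ! i)))"

definition halin_graph :: "'a set \<Rightarrow> 'a set set \<Rightarrow> bool" where
  "halin_graph V E \<longleftrightarrow>
     (\<exists>T p \<gamma> ls. hit V T \<and> 4 \<le> card V \<and> plane_embedding V T p \<gamma> \<and>
        leaf_cyclic_order V T p \<gamma> ls \<and> E = T \<union> cycle_edges ls)"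

definition has_spanning_halin_subgraph :: "'a set \<Rightarrow> 'a set set \<Rightarrow> bool" where
  "has_spanning_halin_subgraph V E \<longleftrightarrow> (\<exists>F \<subseteq> E. halin_graph V F)"

end

theory Submission
  imports Defs
begin

text \<open>Let \<open>S\<close> be the small cut and let \<open>A\<close>, \<open>B\<close> be a partition of \<open>V - S\<close> without edges between them.
  The degree condition forces \<open>A\<close> and \<open>B\<close> to have almost \<open>n / 2\<close> vertices each, and every vertex of
  \<open>A\<close> (or \<open>B\<close>) to miss at most \<open>card S\<close> vertices of its own set. A vertex of \<open>S\<close> is moved to the side
  in which it has more neighbours, about \<open>n / 4\<close> at least. The two resulting sides \<open>V1\<close>, \<open>V2\<close> are
  joined by three disjoint edges \<open>a1 b1\<close>, \<open>a2 b2\<close>, \<open>a3 b3\<close>, again by the degree condition.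

  In \<open>V1\<close> one finds a spanning plane tree with root \<open>a1\<close>, without vertices of degree 2 apart from the
  root, whose leaves in their order from left to right form a path of the graph from \<open>a2\<close> to \<open>a3\<close>;
  likewise in \<open>V2\<close> with root \<open>b1\<close> and a leaf path from \<open>b3\<close> to \<open>b2\<close>. Joining the trees by
  \<open>a1 b1\<close> and the leaf paths by \<open>a2 b2\<close> and \<open>a3 b3\<close> gives the Halin graph. A rooted plane tree is
  drawn in a triangle with its root at the apex and its leaves on the base, so a rectangle
  with the base on one side passes through the leaves in the right order.\<close>

section \<open>Rooted plane trees\<close>

text \<open>A rooted plane tree with vertex set \<open>V\<close>, edge set \<open>E\<close> and root \<open>r\<close>, grown from edges by
  gluing at a common root (which concatenates the children) and by attaching a new root. Here
  \<open>k\<close> is the number of children of \<open>r\<close>, and \<open>ls\<close> lists the childless vertices from left to right.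
  The condition \<open>2 \<le> k\<close> in \<open>stem\<close> excludes vertices of degree 2 other than the root.\<close>

inductive plane_tree :: "'a set \<Rightarrow> 'a set set \<Rightarrow> 'a \<Rightarrow> nat \<Rightarrow> 'a list \<Rightarrow> bool" where
  edge: "r \<noteq> v \<Longrightarrow> plane_tree {r, v} {{r, v}} r 1 [v]"
| stem: "plane_tree V E s k ls \<Longrightarrow> 2 \<le> k \<Longrightarrow> r \<notin> V \<Longrightarrow>
    plane_tree (insert r V) (insert {r, s} E) r 1 ls"
| glue: "plane_tree V1 E1 r k1 ls1 \<Longrightarrow> plane_tree V2 E2 r k2 ls2 \<Longrightarrow> V1 \<inter> V2 = {r} \<Longrightarrow>
    plane_tree (V1 \<union> V2) (E1 \<union> E2) r (k1 + k2) (ls1 @ ls2)"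

section \<open>Vertices, edges and degrees of plane trees\<close>

lemma plane_tree_basic:
  assumes "plane_tree V E r k ls"
  shows "finite V \<and> r \<in> V \<and> (\<forall>e\<in>E. e \<subseteq> V \<and> card e = 2) \<and> set ls \<subseteq> V - {r} \<and> distinct ls
    \<and> 1 \<le> k \<and> ls \<noteq> []"
  using assms
proof induction
  case (glue V1 E1 r k1 ls1 V2 E2 k2 ls2)
  have "set ls1 \<inter> set ls2 = {}" using glue by blast
  then show ?case using glue by auto
qed (auto simp: card_2_iff)

lemma plane_tree_finite_edges:
  assumes "plane_tree V E r k ls"
  shows "finite E"
  by (rule finite_subset[of _ "Pow V"]) (use plane_tree_basic[OF assms] in auto)

lemma plane_tree_edges_disjoint:
  assumes "plane_tree V1 E1 r k1 ls1" "plane_tree V2 E2 r k2 ls2" "V1 \<inter> V2 = {r}"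
  shows "E1 \<inter> E2 = {}"
proof -
  have False if "e \<in> E1" "e \<in> E2" for e
  proof -
    have "e \<subseteq> V1" "e \<subseteq> V2" "card e = 2"
      using that plane_tree_basic[OF assms(1)] plane_tree_basic[OF assms(2)] by auto
    then show False using assms(3) card_mono[of "{r}" e] by auto
  qed
  then show ?thesis by blast
qed

lemma vdegree_Un_disjoint:
  assumes "finite E1" "finite E2" "E1 \<inter> E2 = {}"
  shows "vdegree (E1 \<union> E2) v = vdegree E1 v + vdegree E2 v"
proof -
  have "{e \<in> E1 \<union> E2. v \<in> e} = {e \<in> E1. v \<in> e} \<union> {e \<in> E2. v \<in> e}" by auto
  then show ?thesis using assms unfolding vdegree_def
    by (simp add: card_Un_disjoint disjoint_iff)
qed

lemma vdegree_insert:
  assumes "finite E" "e \<notin> E"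
  shows "vdegree (insert e E) v = (if v \<in> e then 1 else 0) + vdegree E v"
proof -
  have "{f \<in> {e}. v \<in> f} = (if v \<in> e then {e} else {})" by auto
  then show ?thesis using vdegree_Un_disjoint[of "{e}" E v] assms by (simp add: vdegree_def)
qed

lemma vdegree_outside:
  assumes "\<forall>e\<in>E. e \<subseteq> V" "v \<notin> V"
  shows "vdegree E v = 0"
proof -
  have "{e \<in> E. v \<in> e} = {}" using assms by auto
  then show ?thesis unfolding vdegree_def by (simp only: card.empty)
qed

text \<open>A stem gives the old root, with its \<open>k\<close> >= 2 children, one more edge, hence
  degree at least 3. In a gluing every vertex except \<open>r\<close> lies in one tree only and
  keeps its degree.\<close>

lemma plane_tree_vdegree:
  assumes "plane_tree V E r k ls"
  shows "vdegree E r = k \<and> (\<forall>v\<in>set ls. vdegree E v = 1) \<and>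
    (\<forall>v\<in>V - {r} - set ls. 3 \<le> vdegree E v)"
  using assms
proof induction
  case (edge r v)
  have "{e. e = {r, v} \<and> r \<in> e} = {{r, v}}" "{e. e = {r, v} \<and> v \<in> e} = {{r, v}}" by auto
  then show ?case by (auto simp: vdegree_def)
next
  case (stem V E s k ls r)
  note b = plane_tree_basic[OF stem(1)]
  have "{r, s} \<notin> E" using b stem(3) by auto
  then have *: "vdegree (insert {r, s} E) v = (if v \<in> {r, s} then 1 else 0) + vdegree E v" for v
    by (rule vdegree_insert[OF plane_tree_finite_edges[OF stem(1)]])
  have "vdegree E r = 0" by (rule vdegree_outside[of _ V]) (use b stem in auto)
  then show ?case unfolding * using b stem by auto
next
  case (glue V1 E1 r k1 ls1 V2 E2 k2 ls2)
  note b1 = plane_tree_basic[OF glue(1)] and b2 = plane_tree_basic[OF glue(2)]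
  have "E1 \<inter> E2 = {}" by (rule plane_tree_edges_disjoint[OF glue(1-3)])
  then have *: "vdegree (E1 \<union> E2) v = vdegree E1 v + vdegree E2 v" for v
    by (rule vdegree_Un_disjoint[OF plane_tree_finite_edges[OF glue(1)] plane_tree_finite_edges[OF glue(2)]])
  have o1: "vdegree E1 v = 0" if "v \<notin> V1" for v
    by (rule vdegree_outside[of _ V1]) (use b1 that in auto)
  have o2: "vdegree E2 v = 0" if "v \<notin> V2" for v
    by (rule vdegree_outside[of _ V2]) (use b2 that in auto)
  have p1: "vdegree E2 v = 0" if "v \<in> V1" "v \<noteq> r" for v using o2 that glue(3) by blast
  have p2: "vdegree E1 v = 0" if "v \<in> V2" "v \<noteq> r" for v using o1 that glue(3) by blast
  show ?case unfolding *
  proof (intro conjI ballI)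
    show "vdegree E1 r + vdegree E2 r = k1 + k2" using glue by simp
  next
    fix v assume "v \<in> set (ls1 @ ls2)"
    moreover have "set ls1 \<subseteq> V1 - {r}" "set ls2 \<subseteq> V2 - {r}" using b1 b2 by auto
    ultimately consider "v \<in> set ls1" "v \<in> V1" "v \<noteq> r" | "v \<in> set ls2" "v \<in> V2" "v \<noteq> r"
      unfolding set_append by blast
    then show "vdegree E1 v + vdegree E2 v = 1"
      by cases (use glue p1 p2 in auto)
  next
    fix v assume v: "v \<in> V1 \<union> V2 - {r} - set (ls1 @ ls2)"
    then consider "v \<in> V1 - {r} - set ls1" | "v \<in> V2 - {r} - set ls2" by auto
    then show "3 \<le> vdegree E1 v + vdegree E2 v"
      by cases (use glue p1 p2 in auto)
  qed
qed

text \<open>A parent function with a rank \<open>d\<close> decreasing towards the root is enough to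
  recognise a tree. It survives stems (ranks shift by one) and gluing (both ranks vanish at the
  shared root).\<close>

lemma plane_tree_parent:
  assumes "plane_tree V E r k ls"
  shows "\<exists>par d. E = (\<lambda>u. {u, par u}) ` (V - {r}) \<and> d r = (0::nat) \<and>
    (\<forall>u\<in>V - {r}. par u \<in> V \<and> d (par u) < d u)"
  using assms
proof induction
  case (edge r v)
  show ?case
    by (rule exI[of _ "\<lambda>_. r"], rule exI[of _ "\<lambda>u. if u = r then 0 else 1"]) (use edge in auto)
next
  case (stem V E s k ls r)
  note b = plane_tree_basic[OF stem(1)]
  obtain par d where p: "E = (\<lambda>u. {u, par u}) ` (V - {s})" "d s = (0::nat)"
    "\<forall>u\<in>V - {s}. par u \<in> V \<and> d (par u) < d u" using stem by blast
  have "insert r V - {r} = insert s (V - {s})" using b stem by auto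
  moreover have "(\<lambda>u. {u, (par(s := r)) u}) ` (V - {s}) = E" unfolding p(1)
    by (rule image_cong) auto
  ultimately have "insert {r, s} E = (\<lambda>u. {u, (par(s := r)) u}) ` (insert r V - {r})"
    by (simp only: image_insert fun_upd_same) (simp add: insert_commute)
  moreover have "\<forall>u\<in>insert r V - {r}. (par(s := r)) u \<in> insert r V \<and>
     (if (par(s := r)) u = r then 0 else Suc (d ((par(s := r)) u))) < (if u = r then 0 else Suc (d u))"
    using p b stem by auto
  ultimately show ?case
    by (intro exI[of _ "par(s := r)"] exI[of _ "\<lambda>u. if u = r then 0 else Suc (d u)"]) auto
next
  case (glue V1 E1 r k1 ls1 V2 E2 k2 ls2)
  note b1 = plane_tree_basic[OF glue(1)] and b2 = plane_tree_basic[OF glue(2)]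
  obtain p1 d1 where p: "E1 = (\<lambda>u. {u, p1 u}) ` (V1 - {r})" "d1 r = (0::nat)"
    "\<forall>u\<in>V1 - {r}. p1 u \<in> V1 \<and> d1 (p1 u) < d1 u" using glue by blast
  obtain p2 d2 where q: "E2 = (\<lambda>u. {u, p2 u}) ` (V2 - {r})" "d2 r = (0::nat)"
    "\<forall>u\<in>V2 - {r}. p2 u \<in> V2 \<and> d2 (p2 u) < d2 u" using glue by blast
  define p3 where "p3 u = (if u \<in> V1 then p1 u else p2 u)" for u
  define d3 where "d3 u = (if u \<in> V1 then d1 u else d2 u)" for u
  have e1: "p3 u = p1 u" "d3 u = d1 u" if "u \<in> V1" for u using that by (auto simp: p3_def d3_def)
  have e2: "d3 u = d2 u" if "u \<in> V2" for u
    using that glue(3) p(2) q(2) b1 by (cases "u = r") (auto simp: d3_def)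
  have e3: "p3 u = p2 u" if "u \<in> V2 - {r}" for u using that glue(3) by (auto simp: p3_def)
  have "V1 \<union> V2 - {r} = (V1 - {r}) \<union> (V2 - {r})" by auto
  then have "E1 \<union> E2 = (\<lambda>u. {u, p3 u}) ` (V1 \<union> V2 - {r})"
    unfolding p(1) q(1) by (simp add: image_Un e1 e3)
  moreover have "p3 u \<in> V1 \<union> V2 \<and> d3 (p3 u) < d3 u" if "u \<in> V1 \<union> V2 - {r}" for u
  proof (cases "u \<in> V1")
    case True then show ?thesis using that p(3) e1 by auto
  next
    case False
    then have "u \<in> V2 - {r}" using that by auto
    then show ?thesis using q(3) e2 e3 by auto
  qed
  moreover have "d3 r = 0" using e1 p b1 by auto
  ultimately show ?case by blast
qed

section \<open>Walks, and trees given by parent functions\<close>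

lemma graph_walk_append:
  assumes "graph_walk V E xs" "graph_walk V E ys" "{last xs, hd ys} \<in> E"
  shows "graph_walk V E (xs @ ys)"
  unfolding graph_walk_def
proof (intro conjI allI impI)
  show "xs @ ys \<noteq> []" "set (xs @ ys) \<subseteq> V" using assms by (auto simp: graph_walk_def)
  fix i assume i: "Suc i < length (xs @ ys)"
  consider "Suc i < length xs" | "Suc i = length xs" | "length xs \<le> i" by linarith
  then show "{(xs @ ys) ! i, (xs @ ys) ! Suc i} \<in> E"
  proof cases
    case 1 then show ?thesis using assms(1) by (auto simp: graph_walk_def nth_append)
  next
    case 2
    then have "last xs = xs ! i" "hd ys = ys ! 0"
      using assms by (auto simp: graph_walk_def last_conv_nth hd_conv_nth simp flip: 2)
    then show ?thesis using assms(3) 2 by (simp add: nth_append)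
  next
    case 3
    then have "(xs @ ys) ! i = ys ! (i - length xs)" "(xs @ ys) ! Suc i = ys ! Suc (i - length xs)"
      by (auto simp: nth_append Suc_diff_le)
    then show ?thesis using assms(2) i 3 by (auto simp: graph_walk_def)
  qed
qed

lemma graph_walk_rev:
  assumes "graph_walk V E xs"
  shows "graph_walk V E (rev xs)"
  unfolding graph_walk_def
proof (intro conjI allI impI)
  show "rev xs \<noteq> []" "set (rev xs) \<subseteq> V" using assms by (auto simp: graph_walk_def)
  fix i assume i: "Suc i < length (rev xs)"
  define j where "j = length xs - Suc (Suc i)"
  have "rev xs ! i = xs ! Suc j" "rev xs ! Suc i = xs ! j" "Suc j < length xs"
    using i by (auto simp: rev_nth j_def Suc_diff_Suc)
  then show "{rev xs ! i, rev xs ! Suc i} \<in> E" using assms by (auto simp: graph_walk_def insert_commute)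
qed

lemma graph_walk_connect:
  assumes "graph_walk V E xs" "graph_walk V E ys" "last xs = hd ys"
  shows "\<exists>zs. graph_walk V E zs \<and> hd zs = hd xs \<and> last zs = last ys"
proof (cases "tl ys")
  case Nil
  then have "ys = [hd ys]" using assms(2) by (cases ys) (auto simp: graph_walk_def)
  then show ?thesis using assms by (metis last.simps)
next
  case (Cons y zs)
  then have ys: "ys = hd ys # y # zs" using assms(2) by (cases ys) (auto simp: graph_walk_def)
  have "graph_walk V E (y # zs)"
    using assms(2) unfolding graph_walk_def by (subst (asm) (1 2 3 4) ys) force
  moreover have "{last xs, y} \<in> E"
    using assms(2,3) ys unfolding graph_walk_def
    by (metis One_nat_def Suc_less_eq hd_conv_nth length_Cons nth_Cons_0 nth_Cons_Suc zero_less_Suc)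
  ultimately have "graph_walk V E (xs @ y # zs)" using graph_walk_append[OF assms(1)] by simp
  moreover have "last (xs @ y # zs) = last ys" by (subst ys) simp
  moreover have "hd (xs @ y # zs) = hd xs" using assms(1) by (auto simp: graph_walk_def)
  ultimately show ?thesis by blast
qed

text \<open>Connected, since following parents leads every vertex to \<open>r\<close>; acyclic,
  since a vertex of maximal rank on a cycle would have both cycle neighbours equal to its
  parent.\<close>

lemma tree_graph_parent:
  assumes V: "finite V" "r \<in> V"
    and E: "E = (\<lambda>u. {u, par u}) ` (V - {r})"
    and par: "\<And>u. u \<in> V - {r} \<Longrightarrow> par u \<in> V \<and> d (par u) < (d u :: nat)"
  shows "tree_graph V E"
proof -
  have "card {u, par u} = 2" if "u \<in> V - {r}" for u
    using par[OF that] by (cases "u = par u") auto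
  then have "simple_graph V E" unfolding simple_graph_def E using V par by auto
  moreover have "connected_graph V E"
  proof -
    have w: "\<exists>xs. graph_walk V E xs \<and> hd xs = v \<and> last xs = r" if "v \<in> V" for v
      using that
    proof (induction "d v" arbitrary: v rule: less_induct)
      case less
      show ?case
      proof (cases "v = r")
        case True
        then show ?thesis by (intro exI[of _ "[r]"]) (use V in \<open>auto simp: graph_walk_def\<close>)
      next
        case False
        then obtain xs where xs: "graph_walk V E xs" "hd xs = par v" "last xs = r"
          using less par by (metis Diff_iff singletonD)
        have "graph_walk V E [v]" using less by (auto simp: graph_walk_def)
        then have "graph_walk V E ([v] @ xs)"
          by (rule graph_walk_append) (use xs E False less in auto)
        then show ?thesis using xs by (intro exI[of _ "[v] @ xs"]) (auto simp: graph_walk_def)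
      qed
    qed
    have "\<exists>xs. graph_walk V E xs \<and> hd xs = u \<and> last xs = v" if uv: "u \<in> V" "v \<in> V" for u v
    proof -
      obtain xs ys where "graph_walk V E xs" "hd xs = u" "last xs = r"
        "graph_walk V E ys" "hd ys = v" "last ys = r" using w uv by blast
      then show ?thesis using graph_walk_connect[of V E xs "rev ys"] graph_walk_rev
        by (metis graph_walk_def hd_rev last_rev)
    qed
    then show ?thesis using V by (auto simp: connected_graph_def)
  qed
  moreover have "acyclic_graph E"
    unfolding acyclic_graph_def
  proof clarify
    fix c assume c: "3 \<le> length c" "distinct c" "cycle_edges c \<subseteq> E"
    define n where "n = length c"
    obtain i where i: "i < n" "\<And>j. j < n \<Longrightarrow> d (c ! j) \<le> d (c ! i)"
    proof -
      have "finite ((\<lambda>i. d (c ! i)) ` {..<n})" "(\<lambda>i. d (c ! i)) ` {..<n} \<noteq> {}"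
        using c(1) by (auto simp: n_def lessThan_empty_iff)
      from Max_in[OF this] Max_ge[OF this(1)] that show thesis by (smt (verit) imageE image_eqI lessThan_iff)
    qed
    have *: "c ! j = par (c ! i)" if j: "j < n" "{c ! i, c ! j} \<in> E" for j
    proof -
      obtain u where u: "u \<in> V - {r}" "{c ! i, c ! j} = {u, par u}" using j E by auto
      then have "c ! i = u \<and> c ! j = par u \<or> c ! j = u \<and> c ! i = par u" by (auto simp: doubleton_eq_iff)
      then show ?thesis using par[OF u(1)] i(2)[OF j(1)] by auto
    qed
    \<comment> \<open>\<open>j\<close> and \<open>k\<close> are the successor and predecessor of
      \<open>i\<close> on the cycle; they differ because its length is at least 3.\<close>
    define j where "j = Suc i mod n"
    define k where "k = (if i = 0 then n - 1 else i - 1)"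
    have n: "3 \<le> n" using c n_def by simp
    have jk: "j < n" "k < n" using i n by (auto simp: j_def k_def)
    have ki: "Suc k mod n = i" using i n by (auto simp: k_def)
    have "j \<noteq> k"
    proof (cases "Suc i = n")
      case True then show ?thesis using n by (auto simp: j_def k_def)
    next
      case False
      then have "Suc i < n" using i by simp
      then show ?thesis using n by (auto simp: j_def k_def)
    qed
    have "{c ! i, c ! j} \<in> cycle_edges c" unfolding cycle_edges_def j_def n_def using i n_def by auto
    moreover have "{c ! k, c ! (Suc k mod n)} \<in> cycle_edges c"
      unfolding cycle_edges_def n_def using jk n_def by auto
    ultimately have "c ! j = par (c ! i)" "c ! k = par (c ! i)"
      using * c(3) jk ki by (auto simp: insert_commute)
    then show False using \<open>j \<noteq> k\<close> jk c(2) by (metis n_def nth_eq_iff_index_eq)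
  qed
  ultimately show ?thesis by (simp add: tree_graph_def)
qed

text \<open>The bound on \<open>k\<close> keeps the root from having degree 2 or being a leaf
  missing from \<open>ls\<close>.\<close>

lemma plane_tree_hit:
  assumes t: "plane_tree V E r k ls" and k: "3 \<le> k"
  shows "hit V E" "leaves V E = set ls" "4 \<le> card V"
proof -
  note b = plane_tree_basic[OF t]
  note dg = plane_tree_vdegree[OF t]
  obtain par d where p: "E = (\<lambda>u. {u, par u}) ` (V - {r})" 
    "\<forall>u\<in>V - {r}. par u \<in> V \<and> d (par u) < (d u :: nat)" using plane_tree_parent[OF t] by blast
  have tr: "tree_graph V E" by (rule tree_graph_parent[of V r E par d]) (use b p in auto)
  have dd: "vdegree E v = 1 \<or> 3 \<le> vdegree E v" if "v \<in> V" for v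
    using dg that k by (cases "v = r"; cases "v \<in> set ls") auto
  show "hit V E" using tr dd unfolding hit_def by fastforce
  have "v \<in> set ls" if "v \<in> V" "vdegree E v = 1" for v
    using that dg k by (cases "v = r"; cases "v \<in> set ls") force+
  then show "leaves V E = set ls" using dg b by (auto simp: leaves_def)
  \<comment> \<open>\<open>k\<close> is the degree of the root, and each edge joins a vertex other
    than the root to its parent.\<close>
  have "k \<le> card E" using dg plane_tree_finite_edges[OF t]
    by (metis (no_types, lifting) card_mono mem_Collect_eq subsetI vdegree_def)
  also have "\<dots> \<le> card (V - {r})" unfolding p(1) by (rule card_image_le) (use b in auto)
  also have "\<dots> = card V - 1" using b by simp
  finally show "4 \<le> card V" using k by simp
qed

section \<open>Drawing a plane tree in a triangle\<close>

text \<open>The triangle with apex \<open>x + iy\<close> and base \<open>[a, b]\<close> on the real axis, without its two other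
  sides: \<open>z\<close> lies in it iff its projection \<open>(Re z * y - x * Im z) / (y - Im z)\<close> from the apex to
  the real axis lies strictly between \<open>a\<close> and \<open>b\<close>.\<close>

definition wedge :: "real \<Rightarrow> real \<Rightarrow> real \<Rightarrow> real \<Rightarrow> complex set" where
  "wedge x y a b = {z. 0 \<le> Im z \<and> Im z < y \<and> a * (y - Im z) < Re z * y - x * Im z \<and>
     Re z * y - x * Im z < b * (y - Im z)}"

text \<open>Containment in the triangle lets drawings in adjacent triangles meet only in the apex.
  The conditions on the real axis let a curve along the base touch the drawing exactly in the
  leaves, in the order of \<open>ls\<close>.\<close>

definition wedge_embedding where
  "wedge_embedding V E r ls p \<gamma> x y a b \<longleftrightarrow>
     plane_embedding V E p \<gamma> \<and> p r = Complex x y \<and>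
     drawing V E p \<gamma> \<subseteq> insert (Complex x y) (wedge x y a b) \<and>
     (\<forall>v\<in>set ls. Im (p v) = 0) \<and> sorted_wrt (<) (map (\<lambda>v. Re (p v)) ls) \<and>
     (\<forall>z\<in>drawing V E p \<gamma>. Im z = 0 \<longrightarrow> z \<in> p ` set ls)"

text \<open>Allows \<open>p\<close> and the arcs to be redefined outside the part already drawn,
  when drawings are extended or combined.\<close>

lemma wedge_embedding_cong:
  assumes "\<And>v. v \<in> V \<Longrightarrow> p v = q v" "\<And>e. e \<in> E \<Longrightarrow> \<gamma> e = \<delta> e"
    and "\<And>e. e \<in> E \<Longrightarrow> e \<subseteq> V" "set ls \<subseteq> V" "r \<in> V"
    and "wedge_embedding V E r ls p \<gamma> x y a b"
  shows "wedge_embedding V E r ls q \<delta> x y a b"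
proof -
  have 1: "q ` A = p ` A" if "A \<subseteq> V" for A using assms(1) that by force
  have 2: "map (\<lambda>v. Re (q v)) ls = map (\<lambda>v. Re (p v)) ls" using assms(1,4) by (auto intro!: map_cong)
  have 3: "drawing V E q \<delta> = drawing V E p \<gamma>" unfolding drawing_def using 1 assms(2) by auto
  have 4: "inj_on q V \<longleftrightarrow> inj_on p V" using assms(1) by (metis inj_on_cong)
  have 5: "plane_embedding V E q \<delta>"
    using assms(6) 1[OF assms(3)] 1[of "_ \<inter> _"] assms(1-3)
    unfolding wedge_embedding_def plane_embedding_def 4
    by (metis (no_types, lifting) le_infI1)
  have "\<forall>v\<in>set ls. q v = p v" using assms(1,4) by auto
  then show ?thesis using assms(6) 5 assms(1)[OF assms(5)] 1[OF assms(4)]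
    unfolding wedge_embedding_def 2 3 by auto
qed

section \<open>Geometry of triangles with base on the real axis\<close>

lemma closed_segment_Complex:
  assumes "z \<in> closed_segment (Complex x y) (Complex x' y')"
  obtains t where "0 \<le> t" "t \<le> 1" "z = Complex ((1 - t) * x + t * x') ((1 - t) * y + t * y')"
  using assms by (auto simp: closed_segment_def complex_eq_iff)

text \<open>All points of the segment except the apex project from the apex to \<open>m\<close>. The
  height bound and its equality case separate the segment from what is drawn below its lower
  end.\<close>

lemma segment_in_wedge:
  assumes "0 < y" "a < m" "m < b" "0 < s" "s \<le> 1"
    and "z \<in> closed_segment (Complex x y) (Complex ((1 - s) * x + s * m) ((1 - s) * y))"
  shows "z \<in> insert (Complex x y) (wedge x y a b)" "(1 - s) * y \<le> Im z"
    "Im z = (1 - s) * y \<Longrightarrow> z = Complex ((1 - s) * x + s * m) ((1 - s) * y)"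
proof -
  obtain t where t: "0 \<le> t" "t \<le> 1"
    "z = Complex ((1 - t) * x + t * ((1 - s) * x + s * m)) ((1 - t) * y + t * ((1 - s) * y))"
    using assms(6) by (rule closed_segment_Complex)
  define u where "u = t * s"
  have u: "0 \<le> u" "u \<le> s" using t assms mult_right_mono[of t 1 s] by (auto simp: u_def)
  have z: "z = Complex ((1 - u) * x + u * m) ((1 - u) * y)"
    unfolding t(3) u_def by (simp add: algebra_simps)
  show "z \<in> insert (Complex x y) (wedge x y a b)"
  proof (cases "u = 0")
    case True then show ?thesis using z by simp
  next
    case False
    then have u0: "0 < u" using u by simp
    have "a * (u * y) < m * (u * y)" "m * (u * y) < b * (u * y)" using u0 assms by auto
    moreover have "0 \<le> (1 - u) * y" "0 < u * y" using u u0 assms by auto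
    ultimately have "z \<in> wedge x y a b" unfolding wedge_def z by (simp add: algebra_simps)
    then show ?thesis by simp
  qed
  show "(1 - s) * y \<le> Im z" unfolding z using u assms by simp
  assume "Im z = (1 - s) * y"
  then have "u = s" using assms unfolding z by simp
  then show "z = Complex ((1 - s) * x + s * m) ((1 - s) * y)" using z by simp
qed

lemma wedge_mono: "a' \<le> a \<Longrightarrow> b \<le> b' \<Longrightarrow> wedge x y a b \<subseteq> wedge x y a' b'"
proof
  fix z assume ab: "a' \<le> a" "b \<le> b'" and z: "z \<in> wedge x y a b"
  then have "a' * (y - Im z) \<le> a * (y - Im z)" "b * (y - Im z) \<le> b' * (y - Im z)"
    by (auto simp: wedge_def intro!: mult_right_mono)
  then show "z \<in> wedge x y a' b'" using z unfolding wedge_def mem_Collect_eq by linarith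
qed

lemma wedge_disjoint: "wedge x y a m \<inter> wedge x y m b = {}"
  unfolding wedge_def by auto

text \<open>The lower apex is the midpoint between the old apex and the base point \<open>m\<close>,
  so it lies inside the large triangle, and the base is the same.\<close>

lemma subwedge:
  assumes "a < m" "m < b" "0 < y"
  shows "wedge ((x + m) / 2) (y / 2) a b \<subseteq> wedge x y a b"
proof
  fix z assume z: "z \<in> wedge ((x + m) / 2) (y / 2) a b"
  have "a * Im z \<le> m * Im z" "m * Im z \<le> b * Im z"
    using z assms by (auto simp: wedge_def mult_right_mono)
  then show "z \<in> wedge x y a b" using z assms unfolding wedge_def
    by (auto simp: field_simps)
qed

lemma drawing_Un: "drawing (V1 \<union> V2) (E1 \<union> E2) p \<gamma> = drawing V1 E1 p \<gamma> \<union> drawing V2 E2 p \<gamma>"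
  unfolding drawing_def by auto

section \<open>Drawings for the three ways to build a plane tree\<close>

lemma wedge_embedding_edge:
  assumes "r \<noteq> v" "0 < y" "a < b"
  shows "\<exists>p \<gamma>. wedge_embedding {r, v} {{r, v}} r [v] p \<gamma> x y a b"
proof -
  define m where "m = (a + b) / 2"
  have m: "a < m" "m < b" using assms by (auto simp: m_def)
  define P Q where "P = Complex x y" and "Q = Complex m 0"
  define p where "p u = (if u = r then P else Q)" for u
  have PQ: "P \<noteq> Q" using assms by (simp add: P_def Q_def)
  have dr: "drawing {r, v} {{r, v}} p (\<lambda>_. linepath P Q) = closed_segment P Q"
    using assms by (auto simp: drawing_def p_def)
  note sw = segment_in_wedge[OF assms(2) m, of 1 _ x, simplified, folded P_def Q_def]
  have "plane_embedding {r, v} {{r, v}} p (\<lambda>_. linepath P Q)"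
    unfolding plane_embedding_def using assms(1) PQ by (auto simp: p_def inj_on_def)
  moreover have "p r = Complex x y" by (simp add: p_def P_def)
  moreover have "\<forall>z\<in>closed_segment P Q. Im z = 0 \<longrightarrow> z \<in> p ` set [v]"
    using sw(3) assms(1) by (auto simp: p_def)
  ultimately have "wedge_embedding {r, v} {{r, v}} r [v] p (\<lambda>_. linepath P Q) x y a b"
    unfolding wedge_embedding_def dr using sw(1) assms(1) by (auto simp: P_def p_def Q_def)
  then show ?thesis by blast
qed

text \<open>The old tree is drawn at half height over the same base, and the new edge runs from the
  apex to the point \<open>Q\<close> of \<open>s\<close>. The edge stays at height at least
  \<open>y / 2\<close>, the rest of the old drawing lies strictly below, so they meet only in
  \<open>Q\<close>.\<close>

lemma wedge_embedding_stem:
  assumes ab: "0 < y" "a < b" and rV: "r \<notin> V" and s: "s \<in> V"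
    and E: "\<And>e. e \<in> E \<Longrightarrow> e \<subseteq> V" and ls: "set ls \<subseteq> V"
    and w: "wedge_embedding V E s ls p \<gamma> ((x + (a + b) / 2) / 2) (y / 2) a b"
  shows "\<exists>p \<gamma>. wedge_embedding (insert r V) (insert {r, s} E) r ls p \<gamma> x y a b"
proof -
  define m where "m = (a + b) / 2"
  have m: "a < m" "m < b" using ab by (auto simp: m_def)
  define P Q where "P = Complex x y" and "Q = Complex ((x + m) / 2) (y / 2)"
  define q where "q = p(r := P)"
  define \<delta> where "\<delta> = \<gamma>({r, s} := linepath P Q)"
  have rs: "{r, s} \<notin> E" using E rV by blast
  have Qe: "Q = Complex ((1 - 1/2) * x + (1/2) * m) ((1 - 1/2) * y)"
    by (simp add: Q_def field_simps)
  note sw = segment_in_wedge[OF ab(1) m, of "1/2" _ x, folded Qe P_def, simplified]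
  have w': "wedge_embedding V E s ls q \<delta> ((x + m) / 2) (y / 2) a b"
    by (rule wedge_embedding_cong[OF _ _ E ls s w[folded m_def]])
       (use rV rs in \<open>auto simp: q_def \<delta>_def\<close>)
  then have pe: "plane_embedding V E q \<delta>" and qs: "q s = Q"
    and dw: "drawing V E q \<delta> \<subseteq> insert Q (wedge ((x + m) / 2) (y / 2) a b)"
    and z0: "\<And>z. z \<in> drawing V E q \<delta> \<Longrightarrow> Im z = 0 \<Longrightarrow> z \<in> q ` set ls"
    by (auto simp: wedge_embedding_def Q_def)
  have low: "z = Q \<or> Im z < y / 2" if "z \<in> drawing V E q \<delta>" for z
    using that dw by (auto simp: wedge_def)
  have seg: "z = Q" if "z \<in> drawing V E q \<delta>" "z \<in> closed_segment P Q" for z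
    using low[OF that(1)] sw(2)[OF that(2)] by auto
  have qr: "q r = P" by (simp add: q_def)
  have PQ: "P \<noteq> Q" using ab by (simp add: P_def Q_def)
  have \<delta>rs: "\<delta> {r, s} = linepath P Q" by (simp add: \<delta>_def)
  have Pd: "P \<notin> drawing V E q \<delta>" using seg[of P] PQ by auto
  have vd: "q v \<in> drawing V E q \<delta>" if "v \<in> V" for v using that by (auto simp: drawing_def)
  have ed: "path_image (\<delta> e) \<subseteq> drawing V E q \<delta>" if "e \<in> E" for e
    using that by (auto simp: drawing_def)
  have inj: "inj_on q V" using pe by (simp add: plane_embedding_def)
  have dr: "drawing (insert r V) (insert {r, s} E) q \<delta> = drawing V E q \<delta> \<union> closed_segment P Q"
    unfolding drawing_def using \<delta>rs qr by auto
  have "plane_embedding (insert r V) (insert {r, s} E) q \<delta>"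
    unfolding plane_embedding_def
  proof (intro conjI ballI impI)
    show "inj_on q (insert r V)" using inj Pd vd qr rV by (auto simp: inj_on_insert)
  next
    fix e assume e: "e \<in> insert {r, s} E"
    show "arc (\<delta> e)" "{pathstart (\<delta> e), pathfinish (\<delta> e)} = q ` e"
      using pe e qr qs \<delta>rs PQ by (auto simp: plane_embedding_def)
  next
    fix e v assume e: "e \<in> insert {r, s} E" and v: "v \<in> insert r V" and in_e: "q v \<in> path_image (\<delta> e)"
    show "v \<in> e"
    proof (cases "e = {r, s}")
      case True
      then have "q v \<in> closed_segment P Q" using in_e \<delta>rs by simp
      then have "v = r \<or> q v = q s" using seg vd v qs by auto
      then show ?thesis using True inj v s by (auto dest: inj_onD)
    next
      case False
      then have "e \<in> E" using e by simp
      then have "v \<noteq> r" using ed in_e Pd qr by auto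
      then show ?thesis using pe \<open>e \<in> E\<close> v in_e by (auto simp: plane_embedding_def)
    qed
  next
    have X: "path_image (\<delta> {r, s}) \<inter> path_image (\<delta> e) \<subseteq> q ` ({r, s} \<inter> e)" if "e \<in> E" for e
    proof
      fix z assume z: "z \<in> path_image (\<delta> {r, s}) \<inter> path_image (\<delta> e)"
      then have "z = Q" using seg ed[OF that] \<delta>rs by auto
      then have "s \<in> e" using pe that s z qs by (auto simp: plane_embedding_def)
      then show "z \<in> q ` ({r, s} \<inter> e)" using \<open>z = Q\<close> qs by auto
    qed
    fix e f assume "e \<in> insert {r, s} E" "f \<in> insert {r, s} E" "e \<noteq> f"
    then consider "e \<in> E" "f \<in> E" | "e = {r, s}" "f \<in> E" | "f = {r, s}" "e \<in> E" by auto
    then show "path_image (\<delta> e) \<inter> path_image (\<delta> f) \<subseteq> q ` (e \<inter> f)"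
    proof cases
      case 1 then show ?thesis using pe \<open>e \<noteq> f\<close> unfolding plane_embedding_def by blast
    next
      case 2 then show ?thesis using X by simp
    next
      case 3 then show ?thesis using X[of e] by (simp add: Int_commute)
    qed
  qed
  moreover have "drawing V E q \<delta> \<union> closed_segment P Q \<subseteq> insert P (wedge x y a b)"
  proof -
    have "Q \<in> insert P (wedge x y a b)" using sw(1)[of Q] by simp
    then show ?thesis using dw subwedge[OF m ab(1), of x] sw(1) by auto
  qed
  moreover have "z \<in> q ` set ls" if "z \<in> drawing V E q \<delta> \<union> closed_segment P Q" "Im z = 0" for z
    using that z0 sw(2)[of z] ab by auto
  ultimately have "wedge_embedding (insert r V) (insert {r, s} E) r ls q \<delta> x y a b"
    using w' qr unfolding wedge_embedding_def dr P_def by auto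
  then show ?thesis by blast
qed

text \<open>Projections from the common apex fall left of \<open>m\<close> in one part and right of
  it in the other. Hence the drawings share only the apex, which is \<open>r\<close>, and the leaves
  in \<open>ls1\<close> come before those in \<open>ls2\<close>.\<close>

lemma wedge_embedding_glue:
  assumes ab: "0 < y" "a < m" "m < b" and V: "V1 \<inter> V2 = {r}"
    and E1: "\<And>e. e \<in> E1 \<Longrightarrow> e \<subseteq> V1" and E2: "\<And>e. e \<in> E2 \<Longrightarrow> e \<subseteq> V2" and E: "E1 \<inter> E2 = {}"
    and ls: "set ls1 \<subseteq> V1 - {r}" "set ls2 \<subseteq> V2 - {r}"
    and w1: "wedge_embedding V1 E1 r ls1 p1 \<gamma>1 x y a m"
    and w2: "wedge_embedding V2 E2 r ls2 p2 \<gamma>2 x y m b"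
  shows "\<exists>p \<gamma>. wedge_embedding (V1 \<union> V2) (E1 \<union> E2) r (ls1 @ ls2) p \<gamma> x y a b"
proof -
  define p where "p v = (if v \<in> V1 then p1 v else p2 v)" for v
  define \<gamma> where "\<gamma> e = (if e \<in> E1 then \<gamma>1 e else \<gamma>2 e)" for e
  define P where "P = Complex x y"
  have rr: "p1 r = P" "p2 r = P" using w1 w2 by (auto simp: wedge_embedding_def P_def)
  have pp: "p2 v = p v" if "v \<in> V2" for v
    using that V rr by (cases "v = r") (auto simp: p_def)
  have w1': "wedge_embedding V1 E1 r ls1 p \<gamma> x y a m"
    by (rule wedge_embedding_cong[OF _ _ E1 _ _ w1]) (use ls V in \<open>auto simp: p_def \<gamma>_def\<close>)
  have w2': "wedge_embedding V2 E2 r ls2 p \<gamma> x y m b"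
    by (rule wedge_embedding_cong[OF pp _ E2 _ _ w2]) (use ls V E in \<open>auto simp: \<gamma>_def\<close>)
  define D1 D2 where "D1 = drawing V1 E1 p \<gamma>" and "D2 = drawing V2 E2 p \<gamma>"
  have pe1: "plane_embedding V1 E1 p \<gamma>" and pe2: "plane_embedding V2 E2 p \<gamma>" and pr: "p r = P"
    and d1: "D1 \<subseteq> insert P (wedge x y a m)" and d2: "D2 \<subseteq> insert P (wedge x y m b)"
    using w1' w2' by (auto simp: wedge_embedding_def D1_def D2_def P_def)
  have D12: "z = P" if "z \<in> D1" "z \<in> D2" for z
    using that d1 d2 wedge_disjoint[of x y a m b] by auto
  have vd: "v \<in> V1 \<Longrightarrow> p v \<in> D1" "v \<in> V2 \<Longrightarrow> p v \<in> D2" for v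
    by (auto simp: D1_def D2_def drawing_def)
  have ed: "e \<in> E1 \<Longrightarrow> path_image (\<gamma> e) \<subseteq> D1" "e \<in> E2 \<Longrightarrow> path_image (\<gamma> e) \<subseteq> D2" for e
    by (auto simp: D1_def D2_def drawing_def)
  have inj1: "inj_on p V1" and inj2: "inj_on p V2" using pe1 pe2 by (auto simp: plane_embedding_def)
  have r: "r \<in> V1" "r \<in> V2" using V by auto
  have v1: "v = r" if "v \<in> V1" "p v \<in> D2" for v
    using D12[OF vd(1)[OF that(1)] that(2)] inj1 pr r that(1) by (metis inj_onD)
  have v2: "v = r" if "v \<in> V2" "p v \<in> D1" for v
    using D12[OF that(2) vd(2)[OF that(1)]] inj2 pr r that(1) by (metis inj_onD)
  have inc1: "v \<in> e" if "e \<in> E1" "v \<in> V1" "p v \<in> path_image (\<gamma> e)" for e v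
    using pe1 that by (auto simp: plane_embedding_def)
  have inc2: "v \<in> e" if "e \<in> E2" "v \<in> V2" "p v \<in> path_image (\<gamma> e)" for e v
    using pe2 that by (auto simp: plane_embedding_def)
  have "plane_embedding (V1 \<union> V2) (E1 \<union> E2) p \<gamma>"
    unfolding plane_embedding_def
  proof (intro conjI ballI impI)
    show "inj_on p (V1 \<union> V2)"
    proof (rule inj_onI)
      fix u v assume uv: "u \<in> V1 \<union> V2" "v \<in> V1 \<union> V2" "p u = p v"
      then consider "u \<in> V1" "v \<in> V1" | "u \<in> V2" "v \<in> V2" | "u \<in> V1" "v \<in> V2" | "u \<in> V2" "v \<in> V1"
        by blast
      then show "u = v"
      proof cases
        case 1 then show ?thesis using inj1 uv(3) by (auto dest: inj_onD)
      next
        case 2 then show ?thesis using inj2 uv(3) by (auto dest: inj_onD)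
      next
        case 3 then show ?thesis using v1[of u] v2[of v] vd[of u] vd[of v] uv(3) by simp
      next
        case 4 then show ?thesis using v1[of v] v2[of u] vd[of u] vd[of v] uv(3) by simp
      qed
    qed
  next
    fix e assume "e \<in> E1 \<union> E2"
    then show "arc (\<gamma> e)" "{pathstart (\<gamma> e), pathfinish (\<gamma> e)} = p ` e"
      using pe1 pe2 by (auto simp: plane_embedding_def)
  next
    fix e v assume e: "e \<in> E1 \<union> E2" and v: "v \<in> V1 \<union> V2" and pv: "p v \<in> path_image (\<gamma> e)"
    show "v \<in> e"
    proof (cases "e \<in> E1")
      case True
      then have "v \<in> V1" using v v2 ed pv r by blast
      then show ?thesis using inc1 True pv by blast
    next
      case False
      then have e2: "e \<in> E2" using e by blast
      then have "v \<in> V2" using v v1 ed pv r by blast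
      then show ?thesis using inc2 e2 pv by blast
    qed
  next
    have X: "path_image (\<gamma> e) \<inter> path_image (\<gamma> f) \<subseteq> p ` (e \<inter> f)" if "e \<in> E1" "f \<in> E2" for e f
    proof
      fix z assume z: "z \<in> path_image (\<gamma> e) \<inter> path_image (\<gamma> f)"
      then have "z = p r" using D12 ed that pr by blast
      moreover have "r \<in> e \<inter> f" using inc1[OF that(1) r(1)] inc2[OF that(2) r(2)] z \<open>z = p r\<close> by blast
      ultimately show "z \<in> p ` (e \<inter> f)" by blast
    qed
    fix e f assume ef: "e \<in> E1 \<union> E2" "f \<in> E1 \<union> E2" "e \<noteq> f"
    then consider "e \<in> E1" "f \<in> E1" | "e \<in> E2" "f \<in> E2" | "e \<in> E1" "f \<in> E2" | "e \<in> E2" "f \<in> E1"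
      by blast
    then show "path_image (\<gamma> e) \<inter> path_image (\<gamma> f) \<subseteq> p ` (e \<inter> f)"
    proof cases
      case 1 then show ?thesis using pe1 ef(3) unfolding plane_embedding_def by blast
    next
      case 2 then show ?thesis using pe2 ef(3) unfolding plane_embedding_def by blast
    next
      case 3 then show ?thesis using X by blast
    next
      case 4 then show ?thesis using X[of f e] by (simp add: Int_commute)
    qed
  qed
  moreover have "D1 \<union> D2 \<subseteq> insert P (wedge x y a b)"
    using d1 d2 wedge_mono[of a a m b x y] wedge_mono[of a m b b x y] ab by auto
  moreover have "sorted_wrt (<) (map (\<lambda>v. Re (p v)) (ls1 @ ls2))"
  proof -
    have "Re (p u) < Re (p v)" if uv: "u \<in> set ls1" "v \<in> set ls2" for u v
    proof -
      have "u \<in> V1 - {r}" "v \<in> V2 - {r}" using ls uv by auto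
      then have "p u \<noteq> P" "p v \<noteq> P" using pr inj1 inj2 r by (auto dest: inj_onD)
      then have W: "p u \<in> wedge x y a m" "p v \<in> wedge x y m b"
        using vd d1 d2 \<open>u \<in> V1 - {r}\<close> \<open>v \<in> V2 - {r}\<close> by auto
      have "Im (p u) = 0" "Im (p v) = 0" using w1' w2' uv by (auto simp: wedge_embedding_def)
      then show ?thesis using W ab by (auto simp: wedge_def)
    qed
    then show ?thesis using w1' w2' by (auto simp: wedge_embedding_def sorted_wrt_append)
  qed
  ultimately have "wedge_embedding (V1 \<union> V2) (E1 \<union> E2) r (ls1 @ ls2) p \<gamma> x y a b"
    using w1' w2' unfolding wedge_embedding_def drawing_Un D1_def D2_def P_def by auto
  then show ?thesis by blast
qed

lemma plane_tree_wedge_embedding: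
  assumes "plane_tree V E r k ls" "0 < y" "a < b"
  shows "\<exists>p \<gamma>. wedge_embedding V E r ls p \<gamma> x y a b"
  using assms
proof (induction arbitrary: x y a b)
  case (edge r v)
  then show ?case by (intro wedge_embedding_edge)
next
  case (stem V E s k ls r)
  note b = plane_tree_basic[OF stem(1)]
  have "\<exists>p \<gamma>. wedge_embedding V E s ls p \<gamma> ((x + (a + b) / 2) / 2) (y / 2) a b"
    by (rule stem.IH) (use stem.prems in auto)
  then obtain p \<gamma> where w: "wedge_embedding V E s ls p \<gamma> ((x + (a + b) / 2) / 2) (y / 2) a b"
    by blast
  show ?case by (rule wedge_embedding_stem[OF stem.prems stem(3) _ _ _ w]) (use b in auto)
next
  case (glue V1 E1 r k1 ls1 V2 E2 k2 ls2)
  note b1 = plane_tree_basic[OF glue(1)] and b2 = plane_tree_basic[OF glue(2)]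
  define m where "m = (a + b) / 2"
  have m: "a < m" "m < b" using glue by (auto simp: m_def)
  have "\<exists>p \<gamma>. wedge_embedding V1 E1 r ls1 p \<gamma> x y a m"
    by (rule glue.IH(1)[OF glue.prems(1) m(1)])
  then obtain p1 \<gamma>1 where w1: "wedge_embedding V1 E1 r ls1 p1 \<gamma>1 x y a m" by blast
  have "\<exists>p \<gamma>. wedge_embedding V2 E2 r ls2 p \<gamma> x y m b"
    by (rule glue.IH(2)[OF glue.prems(1) m(2)])
  then obtain p2 \<gamma>2 where w2: "wedge_embedding V2 E2 r ls2 p2 \<gamma>2 x y m b" by blast
  have E12: "E1 \<inter> E2 = {}" by (rule plane_tree_edges_disjoint[OF glue(1-3)])
  show ?case
    by (rule wedge_embedding_glue[OF glue.prems(1) m glue(3) _ _ E12 _ _ w1 w2]) (use b1 b2 in auto)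
qed

text \<open>The drawing lies over the open unit interval at heights from 0 to 1, so a rectangle of
  height 2 on this base meets it only at the bottom, in the leaves.\<close>

lemma plane_tree_halin:
  assumes t: "plane_tree V E r k ls" and k: "3 \<le> k"
  shows "halin_graph V (E \<union> cycle_edges ls)"
proof -
  note b = plane_tree_basic[OF t] and h = plane_tree_hit[OF t k]
  obtain p \<gamma> where w: "wedge_embedding V E r ls p \<gamma> (1/2) 1 0 1"
    using plane_tree_wedge_embedding[OF t, of 1 0 1 "1/2"] by auto
  define D where "D = drawing V E p \<gamma>"
  define J where "J = rectpath 0 (Complex 1 2)"
  have pe: "plane_embedding V E p \<gamma>" and D: "D \<subseteq> insert (Complex (1/2) 1) (wedge (1/2) 1 0 1)"
    and sorted: "sorted_wrt (<) (map (\<lambda>v. Re (p v)) ls)"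
    and im0: "\<And>v. v \<in> set ls \<Longrightarrow> Im (p v) = 0"
    and Dls: "\<And>z. z \<in> D \<Longrightarrow> Im z = 0 \<Longrightarrow> z \<in> p ` set ls"
    using w by (auto simp: wedge_embedding_def D_def)
  have strip: "0 < Re z \<and> Re z < 1 \<and> 0 \<le> Im z \<and> Im z \<le> 1" if "z \<in> D" for z
    using that D by (auto simp: wedge_def)
  have lsD: "p v \<in> D" if "v \<in> set ls" for v using b that by (auto simp: D_def drawing_def)
  have J: "path_image J = cbox 0 (Complex 1 2) - box 0 (Complex 1 2)"
    unfolding J_def by (rule path_image_rectpath_cbox_minus_box) auto
  have inJ: "inside (path_image J) = box 0 (Complex 1 2)"
    using inside_frontier_eq_interior[of "cbox 0 (Complex 1 2)"] J
    by (simp add: frontier_cbox interior_cbox convex_box)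
  \<comment> \<open>\<open>rectpath\<close> traverses the bottom side from left to right on the
    first half of the parameter interval, so a leaf is passed at half its real part.\<close>
  have bot: "J t = Complex (2 * t) 0" if "t \<le> 1 / 2" for t
    using that unfolding J_def rectpath_def Let_def joinpaths_def linepath_def
    by (simp add: complex_eq_iff)
  define t where "t i = Re (p (ls ! i)) / 2" for i
  have "leaf_cyclic_order V E p \<gamma> ls"
    unfolding leaf_cyclic_order_def h(2) D_def[symmetric]
  proof (intro conjI exI[of _ J] exI[of _ t] allI impI)
    show "distinct ls" using b by blast
    show "simple_path J" unfolding J_def by (rule simple_path_rectpath) auto
    show "pathfinish J = pathstart J" by (simp add: J_def)
    show "D \<inter> path_image J = p ` set ls"
    proof (intro equalityI subsetI)
      fix z assume z: "z \<in> D \<inter> path_image J"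
      then have "Im z = 0" using strip[of z] by (auto simp: J in_cbox_complex_iff in_box_complex_iff)
      then show "z \<in> p ` set ls" using Dls z by blast
    next
      fix z assume "z \<in> p ` set ls"
      then show "z \<in> D \<inter> path_image J" using lsD im0 strip
        by (fastforce simp: J in_cbox_complex_iff in_box_complex_iff)
    qed
    show "D - p ` set ls \<subseteq> inside (path_image J)"
    proof
      fix z assume z: "z \<in> D - p ` set ls"
      then have "Im z \<noteq> 0" using Dls by blast
      then show "z \<in> inside (path_image J)" using strip[of z] z
        by (auto simp: inJ in_box_complex_iff)
    qed
    show "strict_mono_on {..<length ls} t"
      using sorted by (auto simp: strict_mono_on_def t_def sorted_wrt_iff_nth_less)
    fix i assume i: "i < length ls"
    then have i': "ls ! i \<in> set ls" by simp
    show "0 \<le> t i" "t i < 1" using strip[OF lsD[OF i']] by (auto simp: t_def)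
    show "J (t i) = p (ls ! i)"
      using bot[of "t i"] strip[OF lsD[OF i']] im0[OF i'] by (simp add: t_def complex_eq_iff)
  qed auto
  then show ?thesis unfolding halin_graph_def using h pe by blast
qed

section \<open>Trees inside a graph, and Hamiltonian paths\<close>

abbreviation adj :: "'a set set \<Rightarrow> 'a \<Rightarrow> 'a \<Rightarrow> bool" where
  "adj E u v \<equiv> {u, v} \<in> E"

lemma adj_commute: "adj E u v \<longleftrightarrow> adj E v u"
  by (simp add: insert_commute)

definition nbrs :: "'a set set \<Rightarrow> 'a \<Rightarrow> 'a set" where
  "nbrs E v = {u. adj E u v}"

text \<open>The tree edges are hidden, since later constructions refer only to vertex set, root,
  child count and leaf list. The leaf list must be a path of \<open>G\<close>, as it will become
  part of the outer cycle.\<close>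

definition plane_tree_in :: "'a set set \<Rightarrow> 'a set \<Rightarrow> 'a \<Rightarrow> nat \<Rightarrow> 'a list \<Rightarrow> bool" where
  "plane_tree_in G V r k ls \<longleftrightarrow> successively (adj G) ls \<and> (\<exists>T\<subseteq>G. plane_tree V T r k ls)"

lemma plane_tree_in_basic:
  assumes "plane_tree_in G V r k ls"
  shows "finite V" "r \<in> V" "set ls \<subseteq> V - {r}" "ls \<noteq> []" "distinct ls" "successively (adj G) ls"
proof -
  obtain T where "plane_tree V T r k ls" using assms by (auto simp: plane_tree_in_def)
  from plane_tree_basic[OF this]
  show "finite V" "r \<in> V" "set ls \<subseteq> V - {r}" "ls \<noteq> []" "distinct ls" by simp_all
  show "successively (adj G) ls" using assms by (simp add: plane_tree_in_def)
qed

lemma plane_tree_in_edge: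
  assumes "adj G r v" "r \<noteq> v"
  shows "plane_tree_in G {r, v} r 1 [v]"
  unfolding plane_tree_in_def
  using plane_tree.edge[OF assms(2)] assms(1) by (intro conjI exI[of _ "{{r, v}}"]) simp_all

lemma plane_tree_in_stem:
  assumes "plane_tree_in G V s k ls" "2 \<le> k" "r \<notin> V" "adj G r s"
  shows "plane_tree_in G (insert r V) r 1 ls"
proof -
  obtain T where T: "T \<subseteq> G" "plane_tree V T s k ls" "successively (adj G) ls"
    using assms(1) by (auto simp: plane_tree_in_def)
  from plane_tree.stem[OF T(2) assms(2,3)] T(1,3) assms(4) show ?thesis
    unfolding plane_tree_in_def by (intro conjI exI[of _ "insert {r, s} T"]) simp_all
qed

lemma plane_tree_in_glue:
  assumes "plane_tree_in G V1 r k1 ls1" "plane_tree_in G V2 r k2 ls2" "V1 \<inter> V2 = {r}"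
    "adj G (last ls1) (hd ls2)"
  shows "plane_tree_in G (V1 \<union> V2) r (k1 + k2) (ls1 @ ls2)"
proof -
  obtain T1 T2 where T: "T1 \<subseteq> G" "plane_tree V1 T1 r k1 ls1" "successively (adj G) ls1"
    "T2 \<subseteq> G" "plane_tree V2 T2 r k2 ls2" "successively (adj G) ls2"
    using assms(1,2) by (auto simp: plane_tree_in_def)
  from plane_tree.glue[OF T(2,5) assms(3)] T assms(4) show ?thesis
    unfolding plane_tree_in_def
    by (intro conjI exI[of _ "T1 \<union> T2"]) (simp_all add: successively_append_iff)
qed

text \<open>Gluing one edge \<open>{x, z}\<close> at a time turns a path of neighbours of
  \<open>x\<close> into a run of leaves directly below \<open>x\<close>.\<close>

lemma plane_tree_in_add_leaves:
  assumes "plane_tree_in G U x k ls" "distinct xs" "set xs \<inter> U = {}" "\<And>z. z \<in> set xs \<Longrightarrow> adj G x z"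
    "successively (adj G) (last ls # xs)"
  shows "plane_tree_in G (U \<union> set xs) x (k + length xs) (ls @ xs)"
  using assms
proof (induction xs arbitrary: U k ls)
  case (Cons z xs)
  have x: "x \<in> U" using plane_tree_in_basic(2)[OF Cons.prems(1)] .
  have z: "z \<notin> U" "adj G x z" "adj G (last ls) z" using Cons.prems(3,4,5) by simp_all
  have "plane_tree_in G (U \<union> {x, z}) x (k + 1) (ls @ [z])"
    by (rule plane_tree_in_glue[OF Cons.prems(1) plane_tree_in_edge]) (use z x in auto)
  then have "plane_tree_in G (U \<union> {x, z} \<union> set xs) x (k + 1 + length xs) ((ls @ [z]) @ xs)"
  proof (rule Cons.IH)
    show "distinct xs" "set xs \<inter> (U \<union> {x, z}) = {}" using Cons.prems(2,3) x by auto
    show "adj G x y" if "y \<in> set xs" for y using Cons.prems(4) that by simp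
    show "successively (adj G) (last (ls @ [z]) # xs)" using Cons.prems(5) by simp
  qed
  moreover have "U \<union> {x, z} \<union> set xs = U \<union> set (z # xs)" using x by auto
  ultimately show ?case by simp
qed simp

lemma plane_tree_in_cherry:
  assumes "adj G w u" "adj G w v" "adj G u v" "distinct [w, u, v]"
  shows "plane_tree_in G {w, u, v} w 2 [u, v]"
proof -
  have "plane_tree_in G ({w, u} \<union> {w, v}) w (1 + 1) ([u] @ [v])"
    by (rule plane_tree_in_glue[OF plane_tree_in_edge plane_tree_in_edge]) (use assms in auto)
  moreover have "{w, u} \<union> {w, v} = {w, u, v}" by auto
  ultimately show ?thesis by (simp add: numeral_eq_Suc)
qed

lemma plane_tree_in_claw:
  assumes "adj G w u" "adj G w v" "adj G w t" "adj G u v" "adj G v t" "distinct [w, u, v, t]"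
  shows "plane_tree_in G {w, u, v, t} w 3 [u, v, t]"
proof -
  have "plane_tree_in G ({w, u, v} \<union> {w, t}) w (2 + 1) ([u, v] @ [t])"
    by (rule plane_tree_in_glue[OF plane_tree_in_cherry plane_tree_in_edge]) (use assms in auto)
  moreover have "{w, u, v} \<union> {w, t} = {w, u, v, t}" by auto
  ultimately show ?thesis by (simp add: numeral_eq_Suc)
qed

section \<open>Hamiltonian paths by insertion\<close>

lemma not_successively_split:
  assumes "\<not> successively P xs"
  obtains as u v bs where "xs = as @ u # v # bs" "\<not> P u v"
  using assms
proof (induction xs arbitrary: thesis)
  case (Cons x xs)
  show ?case
  proof (cases "successively P xs")
    case True
    then obtain y ys where "xs = y # ys" "\<not> P x y" using Cons.prems(2) by (cases xs) auto
    then show ?thesis using Cons.prems(1)[of "[]" x y ys] by simp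
  next
    case False
    then obtain as u v bs where "xs = as @ u # v # bs" "\<not> P u v" using Cons.IH by blast
    then show ?thesis using Cons.prems(1)[of "x # as" u v bs] by simp
  qed
qed simp

text \<open>Every entry in \<open>N\<close>, except possibly the last entry of the list, is followed
  by one outside \<open>N\<close>.\<close>

lemma length_le_if_no_consecutive:
  assumes "successively (\<lambda>u v. \<not> (u \<in> N \<and> v \<in> N)) xs"
  shows "length xs \<le> 2 * length (filter (\<lambda>u. u \<notin> N) xs) + 1"
  using assms
proof (induction xs rule: induct_list012)
  case (3 x y zs)
  show ?case
  proof (cases "x \<in> N")
    case True
    then have "y \<notin> N" "successively (\<lambda>u v. \<not> (u \<in> N \<and> v \<in> N)) zs"
      using 3(3) by (auto simp: successively_Cons)
    then show ?thesis using 3(1) by simp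
  next
    case False
    then show ?thesis using 3(2,3) by simp
  qed
qed auto

lemma insertion_position:
  assumes "distinct xs" "card (set xs - N) \<le> d" "2 * d + 2 \<le> length xs"
  obtains as u v bs where "xs = as @ u # v # bs" "u \<in> N" "v \<in> N"
proof -
  have "length (filter (\<lambda>u. u \<notin> N) xs) = card (set xs - N)"
    using assms(1) by (simp add: distinct_card[symmetric] set_diff_eq)
  then have "\<not> successively (\<lambda>u v. \<not> (u \<in> N \<and> v \<in> N)) xs"
    using length_le_if_no_consecutive[of N xs] assms by auto
  then show thesis using that by (elim not_successively_split) auto
qed

lemma ex_outside:
  assumes "finite B" "card B < card A"
  obtains x where "x \<in> A" "x \<notin> B"
  using assms by (metis card_mono not_le subsetI)

text \<open>In a longest path from \<open>p\<close> to \<open>q\<close> with at least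
  \<open>2 * d + 2\<close> vertices nothing of \<open>R\<close> is missing: a missing vertex could
  be inserted between two consecutive neighbours of it, which exist on a path of that
  length.\<close>

lemma hamiltonian_path_near_complete:
  assumes R: "finite R" "4 * d + 10 \<le> card R" and pq: "p \<in> R" "q \<in> R" "p \<noteq> q"
    and miss: "\<And>c. c \<in> R \<Longrightarrow> card (R - nbrs E c) \<le> d"
  obtains xs where "distinct xs" "set xs = R" "hd xs = p" "last xs = q" "successively (adj E) xs"
    "xs \<noteq> []"
proof -
  \<comment> \<open>Greedy extension from \<open>p\<close>: the next vertex avoids \<open>q\<close>,
    the path so far and the at most \<open>d\<close> non-neighbours of its last vertex.\<close>
  have start: "\<exists>xs. length xs = Suc k \<and> distinct xs \<and> hd xs = p \<and> set xs \<subseteq> R - {q} \<and>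
      successively (adj E) xs" if "k \<le> 2 * d + 2" for k
    using that
  proof (induction k)
    case 0
    show ?case by (rule exI[of _ "[p]"]) (use pq in auto)
  next
    case (Suc k)
    then obtain xs where xs: "length xs = Suc k" "distinct xs" "hd xs = p" "set xs \<subseteq> R - {q}"
      "successively (adj E) xs" by auto
    then have ne: "xs \<noteq> []" by auto
    let ?B = "(R - nbrs E (last xs)) \<union> set xs \<union> {q}"
    have "last xs \<in> R" using ne xs by (meson Diff_subset last_in_set subset_iff)
    then have "card ?B \<le> d + Suc k + 1"
      using miss[of "last xs"] card_Un_le[of "R - nbrs E (last xs)" "set xs"]
        card_Un_le[of "(R - nbrs E (last xs)) \<union> set xs" "{q}"] xs distinct_card[of xs] by simp
    then have "card ?B < card R" using R Suc.prems by simp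
    then obtain z where z: "z \<in> R" "z \<notin> ?B" using R by (elim ex_outside[rotated]) auto
    have "adj E (last xs) z" using z by (auto simp: nbrs_def adj_commute)
    then show ?case
      by (intro exI[of _ "xs @ [z]"]) (use xs z ne in \<open>auto simp: successively_append_iff\<close>)
  qed
  define good where "good xs \<longleftrightarrow> distinct xs \<and> set xs \<subseteq> R \<and> hd xs = p \<and> last xs = q \<and>
     successively (adj E) xs \<and> 2 * d + 2 \<le> length xs" for xs
  have "\<exists>xs. good xs"
  proof -
    obtain xs where xs: "length xs = 2 * d + 3" "distinct xs" "hd xs = p" "set xs \<subseteq> R - {q}"
      "successively (adj E) xs" using start[of "2 * d + 2"] by (auto simp: numeral_eq_Suc)
    then have ne: "xs \<noteq> []" by auto
    \<comment> \<open>\<open>z\<close> is to link the greedy path to \<open>q\<close>; at most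
      \<open>4 * d + 4\<close> vertices are excluded.\<close>
    let ?B = "(R - nbrs E (last xs)) \<union> (R - nbrs E q) \<union> (set xs \<union> {q})"
    have "last xs \<in> R" using ne xs by (meson Diff_subset last_in_set subset_iff)
    then have "card ?B \<le> d + d + (2 * d + 3 + 1)"
      using miss[of "last xs"] miss[of q] pq card_Un_le[of "R - nbrs E (last xs)" "R - nbrs E q"]
        card_Un_le[of "(R - nbrs E (last xs)) \<union> (R - nbrs E q)" "set xs \<union> {q}"]
        card_Un_le[of "set xs" "{q}"] xs distinct_card[of xs] by simp
    then have "card ?B < card R" using R by simp
    then obtain z where z: "z \<in> R" "z \<notin> ?B" using R by (elim ex_outside[rotated]) auto
    have "adj E (last xs) z" "adj E z q" using z by (auto simp: nbrs_def adj_commute)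
    then have "good (xs @ [z, q])" unfolding good_def
      using xs z ne pq by (auto simp: successively_append_iff)
    then show ?thesis by blast
  qed
  moreover have "length xs < Suc (card R)" if "good xs" for xs
    using that R card_mono[of R "set xs"] distinct_card[of xs] by (auto simp: good_def)
  ultimately obtain xs where xs: "good xs" and max: "\<And>ys. good ys \<Longrightarrow> length ys \<le> length xs"
    using ex_has_greatest_nat[of good _ length "Suc (card R)"] by blast
  have "v \<in> set xs" if v: "v \<in> R" for v
  proof (rule ccontr)
    assume nv: "v \<notin> set xs"
    have "card (set xs - nbrs E v) \<le> card (R - nbrs E v)"
      by (rule card_mono) (use R xs in \<open>auto simp: good_def\<close>)
    then have "card (set xs - nbrs E v) \<le> d" using miss[OF v] by simp
    then obtain as s t bs where sp: "xs = as @ s # t # bs" "s \<in> nbrs E v" "t \<in> nbrs E v"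
      using xs unfolding good_def by (elim insertion_position[rotated]) auto
    have "good (as @ s # v # t # bs)"
      using xs sp nv v unfolding good_def
      by (auto simp: successively_append_iff successively_Cons nbrs_def hd_append adj_commute)
    then show False using max sp by fastforce
  qed
  then have "set xs = R" "xs \<noteq> []" using xs by (auto simp: good_def)
  then show thesis using that[of xs] xs unfolding good_def by blast
qed

section \<open>One side of the cut\<close>

text \<open>In the application \<open>C\<close> is one side of the graph without the cut,
  \<open>V\<close> adds the cut vertices moved to that side, and \<open>d\<close> is the size of the
  cut.\<close>

locale near_complete =
  fixes V :: "'a set" and E :: "'a set set" and C :: "'a set" and d :: nat
  assumes fin: "finite V" and CV: "C \<subseteq> V"
    and miss: "\<And>c. c \<in> C \<Longrightarrow> card (C - nbrs E c) \<le> d"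
    and out: "card (V - C) \<le> d"
    and deg: "\<And>v. v \<in> V \<Longrightarrow> 20 * d + 50 \<le> card (nbrs E v \<inter> C)"
begin

lemma finC: "finite C" using fin CV finite_subset by blast

text \<open>The degree bound \<open>20 * d + 50\<close> exceeds by one the \<open>2 * d\<close>
  non-neighbours of \<open>c1\<close> and \<open>c2\<close> plus the \<open>18 * d + 49\<close>
  forbidden vertices. Only \<open>v\<close> may lie outside the core: two such vertices may have no
  common neighbour.\<close>

lemma pick:
  assumes "v \<in> V" "c1 \<in> C" "c2 \<in> C" "finite U" "card U \<le> 18 * d + 49"
  shows "\<exists>u. u \<in> C \<and> u \<in> V \<and> u \<notin> U \<and> adj E u v \<and> adj E u c1 \<and> adj E u c2"
proof -
  let ?B = "(C - nbrs E c1) \<union> (C - nbrs E c2) \<union> U"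
  have "card ?B \<le> d + d + (18 * d + 49)"
    using card_Un_le[of "(C - nbrs E c1) \<union> (C - nbrs E c2)" U]
      card_Un_le[of "C - nbrs E c1" "C - nbrs E c2"] miss[OF assms(2)] miss[OF assms(3)] assms(5)
    by linarith
  then have "card ?B < card (nbrs E v \<inter> C)" using deg[OF assms(1)] by simp
  then obtain u where "u \<in> nbrs E v \<inter> C" "u \<notin> ?B"
    using assms(4) finC by (elim ex_outside[rotated]) auto
  then show ?thesis using CV by (intro exI[of _ u]) (auto simp: nbrs_def)
qed

text \<open>A vertex \<open>v\<close> that cannot be a child of the hub \<open>x\<close> becomes the middle leaf below a new child
  \<open>w\<close> of \<open>x\<close>, between two further leaves \<open>s\<close> and \<open>t\<close>. All three are taken from the core \<open>C\<close>, so that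
  only neighbourhoods of core vertices have to be intersected with that of \<open>v\<close>.\<close>

lemma absorb_bad:
  assumes x: "x \<in> C" and X: "plane_tree_in E X0 x k0 ls0" "last ls0 \<in> C" "card X0 \<le> 4"
    and Res: "finite Res" "card Res \<le> 6" "X0 \<inter> Res = {}"
    and Bad: "Bad \<subseteq> V - Res - X0" "card Bad \<le> 2 * d"
    and X0V: "X0 \<subseteq> V"
  shows "B \<subseteq> Bad \<Longrightarrow> \<exists>U k ls. plane_tree_in E U x k ls \<and> X0 \<union> B \<subseteq> U \<and> U \<subseteq> V - Res \<and>
    U \<inter> Bad = B \<and> card U \<le> 4 + 4 * card B \<and> hd ls = hd ls0 \<and> last ls \<in> C"
proof (induction B rule: infinite_finite_induct)
  case (infinite B)
  then show ?case using Bad fin finite_subset by (metis Diff_subset order_trans)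
next
  case empty
  show ?case by (intro exI[of _ X0] exI[of _ k0] exI[of _ ls0]) (use X Bad Res X0V in auto)
next
  case (insert v B)
  then obtain U k ls where U: "plane_tree_in E U x k ls" "X0 \<union> B \<subseteq> U" "U \<subseteq> V - Res" "U \<inter> Bad = B"
    "card U \<le> 4 + 4 * card B" "hd ls = hd ls0" "last ls \<in> C" by blast
  note b = plane_tree_in_basic[OF U(1)]
  have finBad: "finite Bad" using Bad fin finite_subset by (metis Diff_subset order_trans)
  have v: "v \<in> V" "v \<in> Bad" "v \<notin> U" "v \<notin> Res" using insert.prems insert.hyps U(4) Bad by auto
  have "card B \<le> 2 * d" using card_mono[OF finBad, of B] insert.prems Bad by auto
  \<comment> \<open>Bad vertices still to be absorbed and reserved vertices are forbidden too. The
    size is at most \<open>4 + 8 * d\<close> for \<open>U\<close>, \<open>2 * d\<close> for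
    \<open>Bad\<close> and 6 for \<open>Res\<close>.\<close>
  define W where "W = U \<union> Bad \<union> Res"
  have fW: "finite W" using b finBad Res by (simp add: W_def)
  have cW: "card W \<le> 10 * d + 10"
    using card_Un_le[of "U \<union> Bad" Res] card_Un_le[of U Bad] U(5) \<open>card B \<le> 2 * d\<close> Bad Res
    by (simp add: W_def)
  \<comment> \<open>\<open>s\<close> continues the leaf path, so \<open>last ls\<close> has to be a
    core vertex; the new last leaf \<open>t\<close> is one again.\<close>
  obtain s where s: "s \<in> C" "s \<in> V" "s \<notin> W" "adj E s v" "adj E s (last ls)"
    using pick[OF v(1) U(7) U(7) fW] cW by auto
  have cs: "card (insert s W) \<le> 10 * d + 11" using cW fW by (simp add: card_insert_if)
  obtain w where w: "w \<in> C" "w \<in> V" "w \<notin> insert s W" "adj E w v" "adj E w x" "adj E w s"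
    using pick[OF v(1) x s(1), of "insert s W"] fW cs by auto
  have ct: "card (insert w (insert s W)) \<le> 10 * d + 12"
    using cs w fW card_insert_if[of "insert s W" w] by simp
  obtain t where t: "t \<in> C" "t \<in> V" "t \<notin> insert w (insert s W)" "adj E t v" "adj E t w"
    using pick[OF v(1) w(1) w(1), of "insert w (insert s W)"] fW ct by auto
  have n: "v \<notin> {s, w, t}" "x \<notin> {v, s, w, t}" "s \<notin> U" "w \<notin> U" "t \<notin> U" "distinct [w, s, v, t]"
    "{s, w, t} \<inter> (Res \<union> Bad) = {}"
    using s w t v b by (auto simp: W_def)
  have "plane_tree_in E {w, s, v, t} w 3 [s, v, t]"
    by (rule plane_tree_in_claw) (use s w t n in \<open>auto simp: adj_commute\<close>)
  then have "plane_tree_in E (insert x {w, s, v, t}) x 1 [s, v, t]"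
    by (rule plane_tree_in_stem) (use n w in \<open>auto simp: adj_commute\<close>)
  then have P: "plane_tree_in E (U \<union> insert x {w, s, v, t}) x (k + 1) (ls @ [s, v, t])"
    by (rule plane_tree_in_glue[OF U(1)]) (use n b v s in \<open>auto simp: adj_commute\<close>)
  have "card (U \<union> insert x {w, s, v, t}) \<le> card U + card {w, s, v, t}"
    using b card_Un_le[of U "{w, s, v, t}"] by (simp add: insert_absorb)
  also have "\<dots> \<le> card U + 4" using card_length[of "[w, s, v, t]"] by simp
  finally have "card (U \<union> insert x {w, s, v, t}) \<le> 4 + 4 * card (insert v B)"
    using U(5) insert.hyps by simp
  then show ?case
    by (intro exI[of _ "U \<union> insert x {w, s, v, t}"] exI[of _ "k + 1"] exI[of _ "ls @ [s, v, t]"])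
      (use P U n s w t v b in auto)
qed

text \<open>The root \<open>a1\<close> has two core vertices \<open>x\<close> and \<open>y\<close> as children. Below \<open>y\<close> hang only the last
  three leaves \<open>l\<close>, \<open>b3\<close>, \<open>a3\<close>, the last two of them through \<open>w\<close>; the hub \<open>x\<close> carries all other
  vertices of \<open>V\<close>, starting with the leaves \<open>a2\<close>, \<open>b2\<close> below \<open>t\<close>. This works even if \<open>a1\<close>, \<open>a2\<close>
  and \<open>a3\<close> have no common neighbours.\<close>

lemma half_tree:
  assumes a: "a1 \<in> V" "a2 \<in> V" "a3 \<in> V" "distinct [a1, a2, a3]"
  obtains ls where "plane_tree_in E V a1 2 ls" "hd ls = a2" "last ls = a3"
proof -
  \<comment> \<open>\<open>c0\<close> fills both core arguments of \<open>pick\<close> when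
    adjacency to a single vertex is wanted.\<close>
  have "nbrs E a1 \<inter> C \<noteq> {}" using deg[OF a(1)] by auto
  then obtain c0 where c0: "c0 \<in> C" by blast
  have small: "card (set us) \<le> 18 * d + 49" if "length us \<le> 20" for us :: "'a list"
    using card_length[of us] that by linarith
  obtain y where y: "y \<in> C" "y \<in> V" "y \<notin> set [a1, a2, a3]" "adj E y a1"
    using pick[OF a(1) c0 c0 _ small[of "[a1, a2, a3]"]] by auto
  obtain w where w: "w \<in> C" "w \<in> V" "w \<notin> set [a1, a2, a3, y]" "adj E w a3" "adj E w y"
    using pick[OF a(3) y(1) y(1) _ small[of "[a1, a2, a3, y]"]] by auto
  obtain b3 where b3: "b3 \<in> C" "b3 \<in> V" "b3 \<notin> set [a1, a2, a3, y, w]" "adj E b3 a3" "adj E b3 w"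
    using pick[OF a(3) w(1) w(1) _ small[of "[a1, a2, a3, y, w]"]] by auto
  obtain l where l: "l \<in> C" "l \<in> V" "l \<notin> set [a1, a2, a3, y, w, b3]" "adj E l y" "adj E l b3"
    using pick[OF y(2) b3(1) b3(1) _ small[of "[a1, a2, a3, y, w, b3]"]] by auto
  obtain x where x: "x \<in> C" "x \<in> V" "x \<notin> set [a1, a2, a3, y, w, b3, l]" "adj E x a1"
    using pick[OF a(1) c0 c0 _ small[of "[a1, a2, a3, y, w, b3, l]"]] by auto
  obtain t where t: "t \<in> C" "t \<in> V" "t \<notin> set [a1, a2, a3, y, w, b3, l, x]" "adj E t a2" "adj E t x"
    using pick[OF a(2) x(1) x(1) _ small[of "[a1, a2, a3, y, w, b3, l, x]"]] by auto
  obtain b2 where b2: "b2 \<in> C" "b2 \<in> V" "b2 \<notin> set [a1, a2, a3, y, w, b3, l, x, t]"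
      "adj E b2 a2" "adj E b2 t"
    using pick[OF a(2) t(1) t(1) _ small[of "[a1, a2, a3, y, w, b3, l, x, t]"]] by auto
  have "plane_tree_in E {w, b3, a3} w 2 [b3, a3]"
    by (rule plane_tree_in_cherry) (use b3 w in \<open>auto simp: adj_commute\<close>)
  then have T: "plane_tree_in E (insert y {w, b3, a3}) y 1 [b3, a3]"
    by (rule plane_tree_in_stem) (use y w b3 in \<open>auto simp: adj_commute\<close>)
  have "plane_tree_in E ({y, l} \<union> insert y {w, b3, a3}) y (1 + 1) ([l] @ [b3, a3])"
    by (rule plane_tree_in_glue[OF plane_tree_in_edge T]) (use l in \<open>auto simp: adj_commute\<close>)
  then have Y: "plane_tree_in E (insert a1 ({y, l} \<union> insert y {w, b3, a3})) a1 1 ([l] @ [b3, a3])"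
    by (rule plane_tree_in_stem) (use y w b3 l a in \<open>auto simp: adj_commute\<close>)
  define Res where "Res = insert a1 ({y, l} \<union> insert y {w, b3, a3})"
  have Res_set: "Res = set [a1, y, l, w, b3, a3]" by (auto simp: Res_def)
  have "plane_tree_in E {t, a2, b2} t 2 [a2, b2]"
    by (rule plane_tree_in_cherry) (use b2 t in \<open>auto simp: adj_commute\<close>)
  then have X0: "plane_tree_in E (insert x {t, a2, b2}) x 1 [a2, b2]"
    by (rule plane_tree_in_stem) (use x t b2 in \<open>auto simp: adj_commute\<close>)
  define X0 where "X0 = insert x {t, a2, b2}"
  \<comment> \<open>These cannot be hung below \<open>x\<close> at once: they are not adjacent to
    \<open>x\<close>, or lie outside the core, where the Hamiltonian path argument gives no
    control.\<close>
  define Bad where "Bad = {v \<in> V - Res - X0. v \<notin> C \<or> \<not> adj E v x}"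
  have "card Bad \<le> card ((V - C) \<union> (C - nbrs E x))"
    by (rule card_mono) (use fin finC in \<open>auto simp: Bad_def nbrs_def\<close>)
  also have "\<dots> \<le> d + d" using card_Un_le[of "V - C" "C - nbrs E x"] out miss[OF x(1)] by linarith
  finally have cBad: "card Bad \<le> 2 * d" by simp
  have cRes: "card Res \<le> 6" using card_length[of "[a1, y, l, w, b3, a3]"] by (simp add: Res_set)
  have cX0: "card X0 \<le> 4" using card_length[of "[x, t, a2, b2]"] by (simp add: X0_def)
  have ResV: "Res \<subseteq> V" using y w b3 l a by (auto simp: Res_def)
  have disj: "X0 \<inter> Res = {}" using x t b2 a y w b3 l by (auto simp: X0_def Res_def)
  have finRes: "finite Res" by (simp add: Res_set)
  have BadV: "Bad \<subseteq> V - Res - X0" by (auto simp: Bad_def)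
  have X0V: "X0 \<subseteq> V" using x(2) t(2) a(2) b2(2) by (simp add: X0_def)
  have "last [a2, b2] \<in> C" using b2(1) by simp
  from absorb_bad[OF x(1) X0[folded X0_def] this cX0 finRes cRes disj BadV cBad X0V order_refl]
  obtain U k ls where U: "plane_tree_in E U x k ls" "X0 \<union> Bad \<subseteq> U" "U \<subseteq> V - Res"
    "card U \<le> 4 + 4 * card Bad" "hd ls = a2" "last ls \<in> C"
    unfolding list.sel by blast
  note b = plane_tree_in_basic[OF U(1)]
  \<comment> \<open>The remaining vertices are core neighbours of \<open>x\<close>, so a Hamiltonian
    path on them can serve as leaves of \<open>x\<close>.\<close>
  define R where "R = V - Res - U"
  have R: "R \<subseteq> C" "\<And>v. v \<in> R \<Longrightarrow> adj E x v" using U(2) by (auto simp: R_def Bad_def adj_commute)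
  have finR: "finite R" using R finC finite_subset by blast
  have cUR: "card (Res \<union> U) \<le> 8 * d + 10" using card_Un_le[of Res U] cRes U(4) cBad by linarith
  have finUR: "finite (Res \<union> U)" using b by (simp add: Res_set)
  have "20 * d + 50 \<le> card C" using deg[OF a(1)] card_mono[OF finC, of "nbrs E a1 \<inter> C"] by simp
  also have "card C \<le> card (R \<union> (Res \<union> U))"
    by (rule card_mono) (use CV finR finUR in \<open>auto simp: R_def\<close>)
  also have "\<dots> \<le> card R + (8 * d + 10)" using card_Un_le[of R "Res \<union> U"] cUR by linarith
  finally have cR: "4 * d + 10 \<le> card R" by simp
  \<comment> \<open>The path through \<open>R\<close> starts at \<open>p\<close>, next to the last
    leaf so far, and ends at \<open>q\<close>, next to the first leaf \<open>l\<close> below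
    \<open>y\<close>.\<close>
  obtain p where p: "p \<in> V" "p \<notin> Res \<union> U" "adj E p (last ls)"
    using pick[OF x(2) U(6) U(6) finUR] cUR by auto
  have "card (insert p (Res \<union> U)) \<le> 18 * d + 49" using cUR finUR p by (simp add: card_insert_if)
  then obtain q where q: "q \<in> V" "q \<notin> insert p (Res \<union> U)" "adj E q l"
    using pick[OF l(2) c0 c0, of "insert p (Res \<union> U)"] finUR by auto
  have missR: "card (R - nbrs E c) \<le> d" if "c \<in> R" for c
    using card_mono[of "C - nbrs E c" "R - nbrs E c"] finC R that miss[of c] by fastforce
  obtain xs where xs: "distinct xs" "set xs = R" "hd xs = p" "last xs = q" "successively (adj E) xs"
    "xs \<noteq> []"
    by (rule hamiltonian_path_near_complete[OF finR cR _ _ _ missR, of p q])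
      (use p q in \<open>auto simp: R_def\<close>)
  have "plane_tree_in E (U \<union> set xs) x (k + length xs) (ls @ xs)"
    by (rule plane_tree_in_add_leaves[OF U(1) xs(1)])
      (use xs R p in \<open>auto simp: R_def successively_Cons adj_commute\<close>)
  moreover have "2 \<le> k + length xs"
    using xs cR distinct_card[of xs] by simp
  moreover have "a1 \<notin> U \<union> set xs" using U(3) xs(2) by (auto simp: R_def Res_def)
  ultimately have "plane_tree_in E (insert a1 (U \<union> set xs)) a1 1 (ls @ xs)"
    by (rule plane_tree_in_stem) (use x in \<open>simp add: adj_commute\<close>)
  \<comment> \<open>The root has exactly the children \<open>x\<close> and \<open>y\<close>; the
    edge to the other root will raise its degree to 3.\<close>
  then have "plane_tree_in E (insert a1 (U \<union> set xs) \<union> Res) a1 (1 + 1) ((ls @ xs) @ ([l] @ [b3, a3]))"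
    by (rule plane_tree_in_glue[OF _ Y[folded Res_def]])
      (use U(3) xs q in \<open>auto simp: R_def Res_def\<close>)
  moreover have "insert a1 (U \<union> set xs) \<union> Res = V"
    using U(3) xs(2) ResV a(1) by (auto simp: R_def)
  ultimately show thesis using that[of "(ls @ xs) @ ([l] @ [b3, a3])"] U(5) b
    by (simp add: numeral_eq_Suc)
qed

end

section \<open>Joining the two sides\<close>

lemma cycle_edges_subset:
  assumes "successively (adj E) ls" "adj E (last ls) (hd ls)" "ls \<noteq> []"
  shows "cycle_edges ls \<subseteq> E"
proof
  fix e assume "e \<in> cycle_edges ls"
  then obtain i where i: "i < length ls" "e = {ls ! i, ls ! (Suc i mod length ls)}"
    by (auto simp: cycle_edges_def)
  show "e \<in> E"
  proof (cases "Suc i < length ls")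
    case True
    then show ?thesis using assms(1) i by (auto simp: successively_conv_nth)
  next
    case False
    then have "Suc i = length ls" using i by simp
    then have "ls ! i = last ls" "ls ! (Suc i mod length ls) = hd ls"
      using assms(3) by (auto simp: last_conv_nth hd_conv_nth simp flip: \<open>Suc i = length ls\<close>)
    then show ?thesis using assms(2) i by simp
  qed
qed

lemma plane_tree_in_halin:
  assumes "plane_tree_in E V r k ls" "3 \<le> k" "adj E (last ls) (hd ls)"
  shows "has_spanning_halin_subgraph V E"
proof -
  obtain T where T: "T \<subseteq> E" "plane_tree V T r k ls" using assms(1) by (auto simp: plane_tree_in_def)
  have "cycle_edges ls \<subseteq> E"
    using cycle_edges_subset plane_tree_in_basic(4,6)[OF assms(1)] assms(3) by blast
  then show ?thesis
    unfolding has_spanning_halin_subgraph_def using plane_tree_halin[OF T(2) assms(2)] T(1) by blast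
qed

section \<open>Separation by the cut\<close>

lemma vertex_cut_split:
  assumes "vertex_cut V E S"
  obtains A B where "A \<union> B = V - S" "A \<inter> B = {}" "A \<noteq> {}" "B \<noteq> {}"
    "\<And>a b. a \<in> A \<Longrightarrow> b \<in> B \<Longrightarrow> \<not> adj E a b"
proof -
  define F where "F = {e \<in> E. e \<inter> S = {}}"
  obtain u v where uv: "u \<in> V - S" "v \<in> V - S"
    "\<nexists>xs. graph_walk (V - S) F xs \<and> hd xs = u \<and> last xs = v"
    using assms unfolding vertex_cut_def connected_graph_def F_def by blast
  \<comment> \<open>\<open>A\<close> is the component of \<open>u\<close> after deleting
    \<open>S\<close>; the other part may consist of several components.\<close>
  define A where "A = {w \<in> V - S. \<exists>xs. graph_walk (V - S) F xs \<and> hd xs = u \<and> last xs = w}"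
  have "\<not> adj E a b" if ab: "a \<in> A" "b \<in> V - S - A" for a b
  proof
    assume "adj E a b"
    then have "adj F a b" using ab by (auto simp: F_def A_def)
    obtain xs where xs: "graph_walk (V - S) F xs" "hd xs = u" "last xs = a"
      using ab(1) by (auto simp: A_def)
    have "graph_walk (V - S) F [b]" using ab(2) by (simp add: graph_walk_def)
    then have "graph_walk (V - S) F (xs @ [b])"
      using graph_walk_append[OF xs(1)] xs(3) \<open>adj F a b\<close> by simp
    moreover have "hd (xs @ [b]) = u" using xs by (auto simp: graph_walk_def)
    ultimately have "b \<in> A" unfolding A_def using ab(2) by fastforce
    then show False using ab by blast
  qed
  moreover have "u \<in> A" unfolding A_def using uv(1)
    by (auto intro!: exI[of _ "[u]"] simp: graph_walk_def)
  moreover have "v \<in> V - S - A" using uv by (auto simp: A_def)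
  moreover have "A \<subseteq> V - S" by (auto simp: A_def)
  ultimately show thesis by (intro that[of A "V - S - A"]) auto
qed

lemma nbrs_simple_graph:
  assumes "simple_graph V E"
  shows "nbrs E v \<subseteq> V - {v}" "vdegree E v = card (nbrs E v)"
proof -
  have E: "\<And>e. e \<in> E \<Longrightarrow> e \<subseteq> V \<and> card e = 2" using assms by (auto simp: simple_graph_def)
  show "nbrs E v \<subseteq> V - {v}" using E by (fastforce simp: nbrs_def)
  have "{e \<in> E. v \<in> e} = (\<lambda>u. {u, v}) ` nbrs E v"
  proof (intro equalityI subsetI)
    fix e assume "e \<in> {e \<in> E. v \<in> e}"
    then obtain u where "e = {u, v}" using E[of e] by (auto simp: card_2_iff)
    then show "e \<in> (\<lambda>u. {u, v}) ` nbrs E v" using \<open>e \<in> _\<close> by (auto simp: nbrs_def)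
  qed (auto simp: nbrs_def)
  moreover have "inj_on (\<lambda>u. {u, v}) (nbrs E v)" by (auto simp: inj_on_def doubleton_eq_iff)
  ultimately show "vdegree E v = card (nbrs E v)" by (simp add: vdegree_def card_image)
qed

text \<open>Each vertex of the smaller side has two neighbours across. Without three disjoint
  crossing edges all crossing edges end in two vertices \<open>b1\<close>, \<open>b2\<close>. Any
  other \<open>c\<close> in \<open>V2\<close> then has its neighbours in \<open>V2\<close>, so
  \<open>card V2\<close> is at least \<open>card V1 + 3\<close>, which forces three neighbours
  across at \<open>v1\<close>.\<close>

lemma three_matching_aux:
  assumes fin: "finite V1" "finite V2"
    and nb: "\<And>v. nbrs E v \<subseteq> V1 \<union> V2 - {v}"
    and deg: "\<And>v. v \<in> V1 \<union> V2 \<Longrightarrow> card V1 + card V2 + 1 \<le> 2 * card (nbrs E v)"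
    and le: "card V1 \<le> card V2" and big: "4 \<le> card V1"
  shows "\<exists>a1 a2 a3 b1 b2 b3. {a1, a2, a3} \<subseteq> V1 \<and> {b1, b2, b3} \<subseteq> V2 \<and> distinct [a1, a2, a3] \<and>
    distinct [b1, b2, b3] \<and> adj E a1 b1 \<and> adj E a2 b2 \<and> adj E a3 b3"
proof (rule ccontr)
  assume no: "\<not> ?thesis"
  define N where "N v = nbrs E v \<inter> V2" for v
  have no3: False if "{a1, a2, a3} \<subseteq> V1" "distinct [a1, a2, a3]" "distinct [b1, b2, b3]"
    "b1 \<in> N a1" "b2 \<in> N a2" "b3 \<in> N a3" for a1 a2 a3 b1 b2 b3
  proof -
    have "{b1, b2, b3} \<subseteq> V2" "adj E a1 b1" "adj E a2 b2" "adj E a3 b3"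
      using that by (auto simp: N_def nbrs_def adj_commute)
    then show False using no that(1-3) by blast
  qed
  have finN: "finite (N v)" for v using fin by (simp add: N_def)
  have dN: "card V1 + card V2 + 1 \<le> 2 * (card V1 - 1 + card (N v))" if "v \<in> V1" for v
  proof -
    have "card (nbrs E v) \<le> card ((V1 - {v}) \<union> N v)"
      by (rule card_mono) (use fin nb[of v] in \<open>auto simp: N_def\<close>)
    also have "\<dots> \<le> card (V1 - {v}) + card (N v)" by (rule card_Un_le)
    also have "\<dots> = card V1 - 1 + card (N v)" using that fin by simp
    finally show ?thesis using deg[of v] that by simp
  qed
  have N2: "2 \<le> card (N v)" if "v \<in> V1" for v using dN[OF that] le big by simp
  have pick: "\<exists>b. b \<in> N v \<and> b \<noteq> c" if "v \<in> V1" for v c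
    using N2[OF that] card_mono[of "{c}" "N v"] by fastforce
  obtain v1 where v1: "v1 \<in> V1" using ex_outside[of "{}" V1] big by auto
  obtain v2 where v2: "v2 \<in> V1" "v2 \<noteq> v1" using ex_outside[of "{v1}" V1] big by auto
  obtain v3 where v3: "v3 \<in> V1" "v3 \<notin> set [v1, v2]"
    by (rule ex_outside[of "set [v1, v2]" V1]) (use big card_length[of "[v1, v2]"] in auto)
  obtain v4 where v4: "v4 \<in> V1" "v4 \<notin> set [v1, v2, v3]"
    by (rule ex_outside[of "set [v1, v2, v3]" V1]) (use big card_length[of "[v1, v2, v3]"] in auto)
  obtain b1 where b1: "b1 \<in> N v1" using pick[OF v1] by blast
  obtain b2 where b2: "b2 \<in> N v2" "b2 \<noteq> b1" using pick[OF v2(1)] by blast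
  have sub: "N v \<subseteq> {b1, b2}" if v: "v \<in> V1" "v \<noteq> v1" "v \<noteq> v2" for v
  proof
    fix b assume "b \<in> N v"
    then show "b \<in> {b1, b2}" using no3[of v1 v2 v b1 b2 b] v v1 v2 b1 b2 by auto
  qed
  have eq: "N v = {b1, b2}" if v: "v \<in> V1" "v \<noteq> v1" "v \<noteq> v2" for v
    by (rule card_seteq[OF _ sub[OF v]]) (use N2[OF v(1)] card_length[of "[b1, b2]"] in auto)
  \<comment> \<open>For \<open>v1\<close> and \<open>v2\<close> themselves, \<open>v3 b1\<close> and
    \<open>v4 b2\<close> take over as the two disjoint edges.\<close>
  have all: "N v \<subseteq> {b1, b2}" if v: "v \<in> V1" for v
  proof (cases "v = v1 \<or> v = v2")
    case True
    show ?thesis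
    proof
      fix b assume "b \<in> N v"
      then show "b \<in> {b1, b2}"
        using no3[of v3 v4 v b1 b2 b] eq[of v3] eq[of v4] True v3 v4 v b2 by auto
    qed
  next
    case False then show ?thesis using sub v by blast
  qed
  obtain c where c: "c \<in> V2" "c \<notin> set [b1, b2]"
    by (rule ex_outside[of "set [b1, b2]" V2]) (use big le card_length[of "[b1, b2]"] in auto)
  have "nbrs E c \<subseteq> V2 - {c}"
  proof
    fix u assume u: "u \<in> nbrs E c"
    have "u \<notin> V1"
    proof
      assume "u \<in> V1"
      then have "c \<in> N u" using u c by (auto simp: N_def nbrs_def adj_commute)
      then show False using all[OF \<open>u \<in> V1\<close>] c by auto
    qed
    then show "u \<in> V2 - {c}" using u nb[of c] by auto
  qed
  then have "card (nbrs E c) \<le> card (V2 - {c})" by (rule card_mono[rotated]) (use fin in simp)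
  then have "card (nbrs E c) \<le> card V2 - 1" using c fin by simp
  moreover have "card V1 + card V2 + 1 \<le> 2 * card (nbrs E c)" using deg c by blast
  moreover have "card (N v1) \<le> 2"
    using card_mono[OF _ all[OF v1]] card_length[of "[b1, b2]"] by simp
  ultimately show False using dN[OF v1] big le by arith
qed

lemma three_matching:
  assumes fin: "finite V1" "finite V2"
    and nb: "\<And>v. nbrs E v \<subseteq> V1 \<union> V2 - {v}"
    and deg: "\<And>v. v \<in> V1 \<union> V2 \<Longrightarrow> card V1 + card V2 + 1 \<le> 2 * card (nbrs E v)"
    and big: "4 \<le> card V1" "4 \<le> card V2"
  obtains a1 a2 a3 b1 b2 b3 where "{a1, a2, a3} \<subseteq> V1" "{b1, b2, b3} \<subseteq> V2" "distinct [a1, a2, a3]"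
    "distinct [b1, b2, b3]" "adj E a1 b1" "adj E a2 b2" "adj E a3 b3"
proof (cases "card V1 \<le> card V2")
  case True
  have "\<exists>a1 a2 a3 b1 b2 b3. {a1, a2, a3} \<subseteq> V1 \<and> {b1, b2, b3} \<subseteq> V2 \<and> distinct [a1, a2, a3] \<and>
    distinct [b1, b2, b3] \<and> adj E a1 b1 \<and> adj E a2 b2 \<and> adj E a3 b3"
    by (rule three_matching_aux[OF fin nb _ True big(1)]) (rule deg)
  then show thesis by (elim exE conjE) (rule that)
next
  case False
  have "\<exists>a1 a2 a3 b1 b2 b3. {a1, a2, a3} \<subseteq> V2 \<and> {b1, b2, b3} \<subseteq> V1 \<and> distinct [a1, a2, a3] \<and>
    distinct [b1, b2, b3] \<and> adj E a1 b1 \<and> adj E a2 b2 \<and> adj E a3 b3"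
    by (rule three_matching_aux) (use assms False in \<open>auto simp: Un_commute add.commute\<close>)
  then show thesis using that by (metis adj_commute)
qed

text \<open>The neighbours of a vertex of \<open>B\<close> lie in \<open>B\<close> and
  \<open>S\<close>, so \<open>A\<close> has fewer than half of the vertices. A vertex of
  \<open>A\<close> has more than half of them as neighbours, all but \<open>card S\<close> of these
  in \<open>A\<close>.\<close>

lemma near_complete_side:
  assumes fin: "finite V" and V: "V = A \<union> B \<union> S" "A \<inter> B = {}" "A \<inter> S = {}" "B \<inter> S = {}" "B \<noteq> {}"
    and nb: "\<And>v. nbrs E v \<subseteq> V - {v}"
    and no: "\<And>a b. a \<in> A \<Longrightarrow> b \<in> B \<Longrightarrow> \<not> adj E a b"
    and deg: "\<And>v. v \<in> V \<Longrightarrow> card V + 1 \<le> 2 * card (nbrs E v)"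
    and big: "82 * card S + 200 \<le> card V"
    and S': "S' \<subseteq> S" "\<And>v. v \<in> S' \<Longrightarrow> card (nbrs E v \<inter> B) \<le> card (nbrs E v \<inter> A)"
  shows "near_complete (A \<union> S') E A (card S)"
proof
  have finABS: "finite A" "finite B" "finite S" using fin V(1) by auto
  show "finite (A \<union> S')" using finABS S' finite_subset by blast
  show "A \<subseteq> A \<union> S'" by simp
  show "card (A \<union> S' - A) \<le> card S" by (rule card_mono) (use finABS S' in auto)
  have cV: "card V = card A + card B + card S"
    unfolding V(1) using V finABS by (simp add: card_Un_disjoint Int_Un_distrib2)
  have nA: "card (nbrs E a) \<le> card (nbrs E a \<inter> A) + card S" if "a \<in> A" for a
  proof -
    have "nbrs E a \<subseteq> (nbrs E a \<inter> A) \<union> S"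
      using nb[of a] V(1) no[OF that] by (auto simp: nbrs_def adj_commute)
    then have "card (nbrs E a) \<le> card ((nbrs E a \<inter> A) \<union> S)"
      by (rule card_mono[rotated]) (use finABS in simp)
    then show ?thesis using card_Un_le[of "nbrs E a \<inter> A" S] by linarith
  qed
  obtain b where b: "b \<in> B" using V(5) by blast
  have "nbrs E b \<subseteq> (B - {b}) \<union> S" using nb[of b] V(1) no[OF _ b] by (auto simp: nbrs_def)
  then have "card (nbrs E b) \<le> card ((B - {b}) \<union> S)"
    by (rule card_mono[rotated]) (use finABS in simp)
  also have "\<dots> \<le> card (B - {b}) + card S" by (rule card_Un_le)
  also have "\<dots> = card B - 1 + card S" using b finABS by simp
  finally have nB: "card V + 1 \<le> 2 * (card B - 1 + card S)" using deg[of b] b V(1) by simp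
  show "card (A - nbrs E c) \<le> card S" if "c \<in> A" for c
  proof -
    have "card A = card (A - nbrs E c) + card (nbrs E c \<inter> A)"
      using card_Un_disjoint[of "A - nbrs E c" "nbrs E c \<inter> A"] finABS
      by (metis Diff_disjoint Int_Diff_Un Int_Diff_disjoint Int_commute Un_commute finite_Diff finite_Int)
    then show ?thesis using nA[OF that] deg[of c] that V(1) cV nB by simp
  qed
  show "20 * card S + 50 \<le> card (nbrs E v \<inter> A)" if v: "v \<in> A \<union> S'" for v
  proof (cases "v \<in> A")
    case True
    then show ?thesis using nA[OF True] deg[of v] V(1) big by simp
  next
    case False
    then have vS: "v \<in> S'" "v \<in> V" using v S' V(1) by auto
    have "card (nbrs E v) \<le> card ((nbrs E v \<inter> A) \<union> (nbrs E v \<inter> B) \<union> S)"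
      by (rule card_mono) (use nb[of v] V(1) finABS in auto)
    also have "\<dots> \<le> card (nbrs E v \<inter> A) + card (nbrs E v \<inter> B) + card S"
      using card_Un_le[of "(nbrs E v \<inter> A) \<union> (nbrs E v \<inter> B)" S]
        card_Un_le[of "nbrs E v \<inter> A" "nbrs E v \<inter> B"] by linarith
    \<comment> \<open>\<open>A\<close> receives at least a quarter of
      \<open>card V + 1 - 2 * card S\<close>; this is where the constants 82 and 200 come
      from.\<close>
    finally show ?thesis using S'(2)[OF vS(1)] deg[OF vS(2)] big by linarith
  qed
qed

section \<open>Assembly of the Halin graph\<close>

lemma near_complete_card:
  assumes "near_complete V E C d" "v \<in> V"
  shows "4 \<le> card V"
proof -
  interpret near_complete V E C d by fact
  have "card (nbrs E v \<inter> C) \<le> card V" by (rule card_mono[OF fin]) (use CV in auto)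
  then show ?thesis using deg[OF assms(2)] by linarith
qed

lemma small_cut_spanning_halin:
  assumes G: "simple_graph V E"
    and deg: "\<And>v. v \<in> V \<Longrightarrow> card V + 1 \<le> 2 * card (nbrs E v)"
    and S: "vertex_cut V E S" "82 * card S + 200 \<le> card V"
  shows "has_spanning_halin_subgraph V E"
proof -
  have fin: "finite V" using G by (simp add: simple_graph_def)
  obtain A B where AB: "A \<union> B = V - S" "A \<inter> B = {}" "A \<noteq> {}" "B \<noteq> {}"
    "\<And>a b. a \<in> A \<Longrightarrow> b \<in> B \<Longrightarrow> \<not> adj E a b" using vertex_cut_split[OF S(1)] by blast
  have SV: "S \<subseteq> V" using S(1) by (simp add: vertex_cut_def)
  \<comment> \<open>Ties go to the first side; the rest of \<open>S\<close> has more neighbours in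
    \<open>B\<close>, so the same lemma serves both sides.\<close>
  define S1 where "S1 = {v \<in> S. card (nbrs E v \<inter> B) \<le> card (nbrs E v \<inter> A)}"
  define V1 V2 where "V1 = A \<union> S1" and "V2 = B \<union> (S - S1)"
  note nb = nbrs_simple_graph(1)[OF G]
  have n1: "near_complete V1 E A (card S)" unfolding V1_def
    by (rule near_complete_side[where V = V and B = B])
      (use fin AB SV nb deg S(2) in \<open>auto simp: S1_def\<close>)
  have no: "\<not> adj E b a" if "b \<in> B" "a \<in> A" for a b using AB(5) that by (simp add: adj_commute)
  have n2: "near_complete V2 E B (card S)" unfolding V2_def
    by (rule near_complete_side[where V = V and B = A, OF fin _ _ _ _ _ nb no])
      (use AB(1-4) SV deg S(2) in \<open>auto simp: S1_def\<close>)
  have V: "V1 \<inter> V2 = {}" "V1 \<union> V2 = V" using AB(1,2) SV by (auto simp: V1_def V2_def S1_def)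
  have f: "finite V1" "finite V2" using V fin by auto
  have c: "card V = card V1 + card V2" using V f card_Un_disjoint by metis
  obtain a b where "a \<in> V1" "b \<in> V2" using AB by (auto simp: V1_def V2_def)
  then have big: "4 \<le> card V1" "4 \<le> card V2"
    by (auto intro: near_complete_card[OF n1] near_complete_card[OF n2])
  obtain a1 a2 a3 b1 b2 b3 where m: "{a1, a2, a3} \<subseteq> V1" "{b1, b2, b3} \<subseteq> V2" "distinct [a1, a2, a3]"
    "distinct [b1, b2, b3]" "adj E a1 b1" "adj E a2 b2" "adj E a3 b3"
    by (rule three_matching[OF f _ _ big, of E, unfolded V(2) c[symmetric]])
      (use nb deg in auto)
  \<comment> \<open>The leaf paths run from \<open>a2\<close> to \<open>a3\<close> and from
    \<open>b3\<close> to \<open>b2\<close>, so that \<open>a3 b3\<close> and \<open>b2 a2\<close>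
    close them to one cycle.\<close>
  obtain ls1 where l1: "plane_tree_in E V1 a1 2 ls1" "hd ls1 = a2" "last ls1 = a3"
    using near_complete.half_tree[OF n1, of a1 a2 a3] m by auto
  obtain ls2 where l2: "plane_tree_in E V2 b1 2 ls2" "hd ls2 = b3" "last ls2 = b2"
    using near_complete.half_tree[OF n2, of b1 b3 b2] m by auto
  have a1: "a1 \<in> V1" "a1 \<notin> V2" using m(1) V(1) by auto
  \<comment> \<open>\<open>b1\<close> has two children and gets the parent \<open>a1\<close>, while
    \<open>a1\<close> gets \<open>b1\<close> as its third child.\<close>
  have "plane_tree_in E (insert a1 V2) a1 1 ls2"
    by (rule plane_tree_in_stem[OF l2(1)]) (use a1 m in auto)
  then have "plane_tree_in E (V1 \<union> insert a1 V2) a1 (2 + 1) (ls1 @ ls2)"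
    by (rule plane_tree_in_glue[OF l1(1)]) (use a1 V(1) m l1 l2 in auto)
  moreover have "V1 \<union> insert a1 V2 = V" using a1 V(2) by auto
  ultimately have t: "plane_tree_in E V a1 (2 + 1) (ls1 @ ls2)" by (simp only:)
  have "ls1 \<noteq> []" "ls2 \<noteq> []" using plane_tree_in_basic(4) l1(1) l2(1) by fast+
  then have "last (ls1 @ ls2) = b2" "hd (ls1 @ ls2) = a2" using l1(2) l2(3) by simp_all
  then have "adj E (last (ls1 @ ls2)) (hd (ls1 @ ls2))"
    using m(6) by (simp only: insert_commute[of b2 a2])
  then show ?thesis by (rule plane_tree_in_halin[OF t, rotated]) simp
qed

theorem theorem3p1:
  shows "\<exists>\<beta>\<^sub>0::real. 0 < \<beta>\<^sub>0 \<and> \<beta>\<^sub>0 \<le> 1 / (20 * 17 ^ 3) \<and>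
    (\<forall>\<beta>. 0 < \<beta> \<and> \<beta> < \<beta>\<^sub>0 \<longrightarrow>
      (\<exists>N::nat. \<forall>n\<ge>N. \<forall>(V :: 'a set) E.
        simple_graph V E \<and> card V = n \<and>
        real (min_degree V E) \<ge> (real n + 1) / 2 \<and>
        (\<exists>S. vertex_cut V E S \<and> real (card S) \<le> 5 * \<beta> * real n) \<longrightarrow>
        has_spanning_halin_subgraph V E))"
proof (intro exI[of _ "1 / (20 * 17 ^ 3)"] conjI allI impI exI[of _ "400::nat"])
  fix \<beta> :: real and n :: nat and V :: "'a set" and E
  assume \<beta>: "0 < \<beta> \<and> \<beta> < 1 / (20 * 17 ^ 3)" and n: "400 \<le> n"
    and H: "simple_graph V E \<and> card V = n \<and> real (min_degree V E) \<ge> (real n + 1) / 2 \<and>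
        (\<exists>S. vertex_cut V E S \<and> real (card S) \<le> 5 * \<beta> * real n)"
  then obtain S where S: "vertex_cut V E S" "real (card S) \<le> 5 * \<beta> * real n" by blast
  have fin: "finite V" using H by (simp add: simple_graph_def)
  \<comment> \<open>The cut then has at most \<open>n / 200\<close> vertices, and
    \<open>82 * n / 200 + 200\<close> is at most \<open>n\<close> once \<open>n\<close> is at least
    400.\<close>
  have "\<beta> \<le> 1 / 1000" using \<beta> by simp
  then have "5 * \<beta> * real n \<le> 5 * (1 / 1000) * real n" by (intro mult_right_mono mult_left_mono) auto
  then have "real (card S) \<le> real n / 200" using S(2) by linarith
  then have "real (82 * card S + 200) \<le> real n" using n by simp
  then have cS: "82 * card S + 200 \<le> card V" using H by linarith
  have "card V + 1 \<le> 2 * card (nbrs E v)" if "v \<in> V" for v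
  proof -
    have "min_degree V E \<le> vdegree E v" unfolding min_degree_def using fin that by simp
    then show ?thesis using H nbrs_simple_graph(2)[of V E v] by simp
  qed
  then show "has_spanning_halin_subgraph V E"
    using small_cut_spanning_halin[OF _ _ S(1) cS] H by blast
qed auto

end
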